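(* Let $n\ge4$, let $q$ be a prime power, and let $J=J^{w_0}$ be a set of types of the oriflamme complex of the hyperbolic quadric of rank $n$ over $\mathbb{F}_q$. Let $C$ be the set of all flags of type $J$ satisfying one of the following conditions: (i) $1\in J$, and the point of the flag lies in a fixed generator; (ii) $n\in J$ (resp. $n'\in J$), $n$ is even, and the subspace of type $n$ (resp. $n'$) of the flag contains a fixed point; (iii) $n=4$, $n\in J$ (resp. $n'\in J$), and the subspace of type $n$ (resp. $n'$) of the flag is incident with a fixed subspace of type $n'$ (resp. $n$). Then $C$ is an EKR-set of flags of type $J$ and $|C|=\dfrac{v}{1+q^{n-1}}$, where $v$ is the total number of flags of type $J$.
   Context: The hyperbolic quadric of rank $n$ is the polar space of nonzero totally singular subspaces of a nondegenerate hyperbolic quadratic form on $\mathbb{F}_q^{2n}$. Its $n$-dimensional subspaces (generators) fall into two classes, $N_1,N_2$ being in the same class iff $\dim(N_1\cap N_2)\equiv n\pmod2$. The oriflamme complex has as elements the totally singular subspaces of dimension $i$ (type $i$) for $1\le i\le n-2$, and the generators of the two classes (types $n$ and $n'$). Incidence is inclusion, except that generators of types $n$ and $n'$ are incident if they meet in an $(n-1)$-dimensional subspace. A flag is a set of pairwise incident elements; its type is the set of types of its members, a subset of $\{1,\dots,n-2,n,n'\}$. Two points are collinear if they span a totally singular subspace; a polar frame is a set of $2n$ points $\{e_{-n},\dots,e_{-1},e_1,\dots,e_n\}$ with each $e_i$ collinear with all points of the set except $e_{-i}$. Fix a polar frame and the maximal flag $F=\{\langle e_1\rangle,\dots,\langle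 e_1,\dots,e_{n-2}\rangle,\langle e_1,\dots,e_{n-1},e_n\rangle,\langle e_1,\dots,e_{n-1},e_{-n}\rangle\}$. Let $G=\mathrm{PGO}^+(2n,q)$ acting on the oriflamme complex type-preservingly (preserving both classes of generators), and $B$ the stabilizer of $F$; $G$ is transitive on maximal flags. The Weyl group of type $D_n$ is the group of permutations of $\{\pm1,\dots,\pm n\}$ generated by $s_i=(i,i+1)(-i,-i-1)$, $1\le i\le n-1$, and $u=ts_{n-1}t$ with $t=(-n,n)$; it acts on the frame by permuting indices (induced by elements of $G$). Its longest element is $w_0=(1,-1)\cdots(n,-n)$ if $n$ is even and $w_0=(1,-1)\cdots(n-1,-(n-1))$ if $n$ is odd. The induced action $J\mapsto J^{w_0}$ on types is trivial for $n$ even; for $n$ odd it swaps $n$ and $n'$ and fixes all other types. Two maximal flags $gF,hF$ are opposite if $Bh^{-1}gB=Bw_0B$. Two flags of types $J$ and $K$ are opposite if $J^{w_0}=K$ and they can be extended to two opposite maximal flags. An EKR-set of flags of type $J=J^{w_0}$ is a set of such flags no two of which are opposite. *)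

theory Defs
  imports "HOL-Analysis.Cartesian_Space"
begin

section \<open>Hyperbolic quadrics\<close>

definition polar_form :: "('a::field ^ 'm \<Rightarrow> 'a) \<Rightarrow> 'a ^ 'm \<Rightarrow> 'a ^ 'm \<Rightarrow> 'a" where
  "polar_form Q x y = Q (x + y) - Q x - Q y"

definition quadratic_form :: "('a::field ^ 'm \<Rightarrow> 'a) \<Rightarrow> bool" where
  "quadratic_form Q \<longleftrightarrow>
     (\<forall>c x. Q (c *s x) = c\<^sup>2 * Q x) \<and>
     (\<forall>x. Vector_Spaces.linear (*s) (*) (\<lambda>y. polar_form Q x y)) \<and>
     (\<forall>y. Vector_Spaces.linear (*s) (*) (\<lambda>x. polar_form Q x y))"

definition nondegenerate :: "('a::field ^ 'm \<Rightarrow> 'a) \<Rightarrow> bool" where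
  "nondegenerate Q \<longleftrightarrow> (\<forall>x. Q x = 0 \<and> (\<forall>y. polar_form Q x y = 0) \<longrightarrow> x = 0)"

definition totally_singular :: "('a::field ^ 'm \<Rightarrow> 'a) \<Rightarrow> ('a ^ 'm) set \<Rightarrow> bool" where
  "totally_singular Q U \<longleftrightarrow> vec.subspace U \<and> (\<forall>x\<in>U. Q x = 0)"

definition point :: "('a::field ^ 'm \<Rightarrow> 'a) \<Rightarrow> ('a ^ 'm) set \<Rightarrow> bool" where
  "point Q P \<longleftrightarrow> totally_singular Q P \<and> vec.dim P = 1"

definition generator :: "nat \<Rightarrow> ('a::field ^ 'm \<Rightarrow> 'a) \<Rightarrow> ('a ^ 'm) set \<Rightarrow> bool" where
  "generator n Q N \<longleftrightarrow> totally_singular Q N \<and> vec.dim N = n"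

text \<open>A nondegenerate quadratic form in dimension \<open>2n\<close> has Witt index at most \<open>n\<close>; it is
  hyperbolic when the bound is attained.\<close>

definition hyperbolic_form :: "nat \<Rightarrow> ('a::field ^ 'm \<Rightarrow> 'a) \<Rightarrow> bool" where
  "hyperbolic_form n Q \<longleftrightarrow>
     CARD('m) = 2 * n \<and> quadratic_form Q \<and> nondegenerate Q \<and> (\<exists>N. generator n Q N)"

text \<open>Meant for generators only.\<close>

definition same_class :: "nat \<Rightarrow> ('a::field ^ 'm) set \<Rightarrow> ('a ^ 'm) set \<Rightarrow> bool" where
  "same_class n N1 N2 \<longleftrightarrow> vec.dim (N1 \<inter> N2) mod 2 = n mod 2"

definition collinear_points ::
    "('a::field ^ 'm \<Rightarrow> 'a) \<Rightarrow> ('a ^ 'm) set \<Rightarrow> ('a ^ 'm) set \<Rightarrow> bool" where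
  "collinear_points Q P R \<longleftrightarrow> totally_singular Q (vec.span (P \<union> R))"

definition frame_index :: "nat \<Rightarrow> int set" where
  "frame_index n = {- int n..int n} - {0}"

text \<open>A frame is given as an indexed family: \<open>e i\<close> is the point with index \<open>i\<close>, itself a
  one-dimensional subspace. Only the values on \<^term>\<open>frame_index n\<close> matter. A point is
  collinear with itself.\<close>

definition polar_frame ::
    "nat \<Rightarrow> ('a::field ^ 'm \<Rightarrow> 'a) \<Rightarrow> (int \<Rightarrow> ('a ^ 'm) set) \<Rightarrow> bool" where
  "polar_frame n Q e \<longleftrightarrow>
     (\<forall>i\<in>frame_index n. point Q (e i)) \<and> inj_on e (frame_index n) \<and>
     (\<forall>i\<in>frame_index n. \<forall>j\<in>frame_index n. collinear_points Q (e i) (e j) \<longleftrightarrow> j \<noteq> - i)"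

definition frame_span :: "(int \<Rightarrow> ('a::field ^ 'm) set) \<Rightarrow> int set \<Rightarrow> ('a ^ 'm) set" where
  "frame_span e I = vec.span (\<Union>i\<in>I. e i)"


section \<open>The oriflamme complex\<close>

text \<open>The type \<open>i\<close> is \<open>Plain i\<close>, the type \<open>n'\<close> is \<open>Primed n\<close>.\<close>

datatype otype = Plain nat | Primed nat

definition otypes :: "nat \<Rightarrow> otype set" where
  "otypes n = Plain ` {1..n - 2} \<union> {Plain n, Primed n}"

definition is_element :: "nat \<Rightarrow> ('a::field ^ 'm \<Rightarrow> 'a) \<Rightarrow> ('a ^ 'm) set \<Rightarrow> bool" where
  "is_element n Q U \<longleftrightarrow>
     totally_singular Q U \<and> (vec.dim U \<in> {1..n - 2} \<or> vec.dim U = n)"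

text \<open>The frame only fixes which class of generators is called \<open>n\<close>: the one of
  \<open>\<langle>e\<^sub>1, \<dots>, e\<^sub>n\<rangle>\<close>.\<close>

definition type_of :: "nat \<Rightarrow> (int \<Rightarrow> ('a::field ^ 'm) set) \<Rightarrow> ('a ^ 'm) set \<Rightarrow> otype" where
  "type_of n e U =
     (if vec.dim U \<noteq> n then Plain (vec.dim U)
      else if same_class n U (frame_span e {1..int n}) then Plain n
      else Primed n)"

definition incident ::
    "nat \<Rightarrow> (int \<Rightarrow> ('a::field ^ 'm) set) \<Rightarrow> ('a ^ 'm) set \<Rightarrow> ('a ^ 'm) set \<Rightarrow> bool" where
  "incident n e U W \<longleftrightarrow>
     (if {type_of n e U, type_of n e W} = {Plain n, Primed n}
      then vec.dim (U \<inter> W) = n - 1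
      else U \<subseteq> W \<or> W \<subseteq> U)"

definition is_flag ::
    "nat \<Rightarrow> ('a::field ^ 'm \<Rightarrow> 'a) \<Rightarrow> (int \<Rightarrow> ('a ^ 'm) set) \<Rightarrow> ('a ^ 'm) set set \<Rightarrow> bool" where
  "is_flag n Q e \<Phi> \<longleftrightarrow>
     (\<forall>U\<in>\<Phi>. is_element n Q U) \<and> (\<forall>U\<in>\<Phi>. \<forall>W\<in>\<Phi>. incident n e U W)"

definition flag_type ::
    "nat \<Rightarrow> (int \<Rightarrow> ('a::field ^ 'm) set) \<Rightarrow> ('a ^ 'm) set set \<Rightarrow> otype set" where
  "flag_type n e \<Phi> = type_of n e ` \<Phi>"

definition flags_of_type ::
    "nat \<Rightarrow> ('a::field ^ 'm \<Rightarrow> 'a) \<Rightarrow> (int \<Rightarrow> ('a ^ 'm) set) \<Rightarrow> otype set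
      \<Rightarrow> ('a ^ 'm) set set set" where
  "flags_of_type n Q e J = {\<Phi>. is_flag n Q e \<Phi> \<and> flag_type n e \<Phi> = J}"

definition maximal_flag ::
    "nat \<Rightarrow> ('a::field ^ 'm \<Rightarrow> 'a) \<Rightarrow> (int \<Rightarrow> ('a ^ 'm) set) \<Rightarrow> ('a ^ 'm) set set \<Rightarrow> bool" where
  "maximal_flag n Q e \<Phi> \<longleftrightarrow>
     is_flag n Q e \<Phi> \<and> (\<forall>\<Psi>. is_flag n Q e \<Psi> \<and> \<Phi> \<subseteq> \<Psi> \<longrightarrow> \<Psi> = \<Phi>)"

definition standard_flag ::
    "nat \<Rightarrow> (int \<Rightarrow> ('a::field ^ 'm) set) \<Rightarrow> ('a ^ 'm) set set" where
  "standard_flag n e =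
     {frame_span e {1..int i} | i. i \<in> {1..n - 2}} \<union>
     {frame_span e {1..int n}, frame_span e ({1..int n - 1} \<union> {- int n})}"


section \<open>The group, and opposition\<close>

text \<open>A projectivity is the permutation of the subspaces induced by an invertible linear map, so
  that scalars act trivially. It is extended by the identity to sets that are not subspaces, to
  make it a permutation of the whole type.\<close>

definition projectivity :: "('a::field ^ 'm \<Rightarrow> 'a ^ 'm) \<Rightarrow> ('a ^ 'm) set \<Rightarrow> ('a ^ 'm) set" where
  "projectivity f U = (if vec.subspace U then f ` U else U)"

text \<open>The projectivities preserving the quadric (those induced by similarities of the form) and
  each of the two classes of generators.\<close>

definition PGO :: "nat \<Rightarrow> ('a::field ^ 'm \<Rightarrow> 'a) \<Rightarrow> (('a ^ 'm) set \<Rightarrow> ('a ^ 'm) set) set" where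
  "PGO n Q = {projectivity f | f.
     Vector_Spaces.linear (*s) (*s) f \<and> bij f \<and>
     (\<exists>c. c \<noteq> 0 \<and> (\<forall>x. Q (f x) = c * Q x)) \<and>
     (\<forall>N. generator n Q N \<longrightarrow> same_class n N (f ` N))}"

definition Borel ::
    "nat \<Rightarrow> ('a::field ^ 'm \<Rightarrow> 'a) \<Rightarrow> (int \<Rightarrow> ('a ^ 'm) set)
      \<Rightarrow> (('a ^ 'm) set \<Rightarrow> ('a ^ 'm) set) set" where
  "Borel n Q e = {g \<in> PGO n Q. g ` standard_flag n e = standard_flag n e}"

definition double_coset :: "('b \<Rightarrow> 'b) set \<Rightarrow> ('b \<Rightarrow> 'b) \<Rightarrow> ('b \<Rightarrow> 'b) set" where
  "double_coset B g = {b \<circ> g \<circ> b' | b b'. b \<in> B \<and> b' \<in> B}"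

text \<open>The longest element of the Weyl group of type \<open>D\<^sub>n\<close>, as a permutation of
  \<^term>\<open>frame_index n\<close>.\<close>

definition w0 :: "nat \<Rightarrow> int \<Rightarrow> int" where
  "w0 n i = (if odd n \<and> \<bar>i\<bar> = int n then i else - i)"

fun w0_type :: "nat \<Rightarrow> otype \<Rightarrow> otype" where
  "w0_type n (Plain i) = (if odd n \<and> i = n then Primed n else Plain i)"
| "w0_type n (Primed i) = (if odd n \<and> i = n then Plain n else Primed i)"

text \<open>In \<open>B w\<^sub>0 B\<close> any group element inducing \<open>w\<^sub>0\<close> on the frame may be taken as the
  representative, since two of them differ by an element fixing all points of the frame, hence
  lying in \<open>B\<close>.\<close>

definition opposite_maximal ::
    "nat \<Rightarrow> ('a::field ^ 'm \<Rightarrow> 'a) \<Rightarrow> (int \<Rightarrow> ('a ^ 'm) set)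
      \<Rightarrow> ('a ^ 'm) set set \<Rightarrow> ('a ^ 'm) set set \<Rightarrow> bool" where
  "opposite_maximal n Q e M1 M2 \<longleftrightarrow>
     (\<exists>g\<in>PGO n Q. \<exists>h\<in>PGO n Q. \<exists>w\<in>PGO n Q.
        M1 = g ` standard_flag n e \<and> M2 = h ` standard_flag n e \<and>
        (\<forall>i\<in>frame_index n. w (e i) = e (w0 n i)) \<and>
        double_coset (Borel n Q e) (inv h \<circ> g) = double_coset (Borel n Q e) w)"

definition opposite_flags ::
    "nat \<Rightarrow> ('a::field ^ 'm \<Rightarrow> 'a) \<Rightarrow> (int \<Rightarrow> ('a ^ 'm) set)
      \<Rightarrow> ('a ^ 'm) set set \<Rightarrow> ('a ^ 'm) set set \<Rightarrow> bool" where
  "opposite_flags n Q e \<Phi> \<Psi> \<longleftrightarrow>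
     w0_type n ` flag_type n e \<Phi> = flag_type n e \<Psi> \<and>
     (\<exists>M1 M2. maximal_flag n Q e M1 \<and> maximal_flag n Q e M2 \<and>
        \<Phi> \<subseteq> M1 \<and> \<Psi> \<subseteq> M2 \<and> opposite_maximal n Q e M1 M2)"

definition EKR_set ::
    "nat \<Rightarrow> ('a::field ^ 'm \<Rightarrow> 'a) \<Rightarrow> (int \<Rightarrow> ('a ^ 'm) set) \<Rightarrow> otype set
      \<Rightarrow> ('a ^ 'm) set set set \<Rightarrow> bool" where
  "EKR_set n Q e J C \<longleftrightarrow>
     w0_type n ` J = J \<and> C \<subseteq> flags_of_type n Q e J \<and>
     pairwise (\<lambda>\<Phi> \<Psi>. \<not> opposite_flags n Q e \<Phi> \<Psi>) C"

end

theory Submission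
  imports Defs
begin

text \<open>
  \<^bold>\<open>Why no two flags of \<open>C\<close> are opposite.\<close>
  Multiplying out the equality of double cosets in the definition of opposition
  (lemma \<open>opposite_maximal_normal_form\<close>) shows that two opposite maximal flags are the images,
  under one common similarity \<open>k\<close> of the form, of the standard flag and of the standard flag with its
  frame indices permuted by \<open>w\<^sub>0\<close>. So their points are \<open>k(e\<^sub>1)\<close> and \<open>k(e\<^sub>-\<^sub>1)\<close>, which are not collinear
  and cannot lie in a common generator. For even \<open>n\<close> their generators are spanned by images of
  sets \<open>I\<close> and \<open>- I'\<close> of frame indices that share at most one index; two of the same class meet in
  even dimension, hence trivially. Then they have no common point, and for \<open>n = 4\<close> they cannot both
  contain a hyperplane of the same four-dimensional space.

  \<^bold>\<open>Why \<open>C\<close> has the right size.\<close>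
  In each case \<open>C\<close> consists of the flags whose element of one given type \<open>t\<close> satisfies a condition
  \<open>A\<close>, where \<open>t\<close> is the type of points or one of the two types of generators. The isometries that
  preserve both classes of generators are transitive on the elements of type \<open>t\<close>, so every
  such element is in the same number of flags of type \<open>J\<close>, and the ratio of
  \<open>card C\<close> to the number of all flags is the ratio of the number of elements of type \<open>t\<close> satisfying
  \<open>A\<close> to the number of all of them (lemma \<open>card_flags_ratio\<close>). What is left is
  to see three times that this ratio is \<open>1 / (1 + q ^ (n - 1))\<close>: for the points in a generator
  (\<open>card_points_ratio\<close>), for the generators of a class on a point
  (\<open>card_generators_of_class_ratio\<close>), and for the generators of one class adjacent to a generator of
  the other class when \<open>n = 4\<close> (\<open>card_adjacent_generators_ratio\<close>).

  \<^bold>\<open>How the objects are counted.\<close>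
  Everything rests on the number of singular vectors orthogonal to a totally singular subspace \<open>K\<close>
  (\<open>card_singular_perp_Diff\<close>), which comes from looking at the cosets of a generator through \<open>K\<close>: on
  a coset other than the generator itself, the form is a nonconstant affine function.
  Incidences between such vectors and generators then give the number of generators
  of one class through \<open>K\<close>, by induction on the codimension of \<open>K\<close> in a generator
  (\<open>card_generators_of_class_through\<close>).

  \<^bold>\<open>The two classes.\<close>
  That \<open>same_class\<close> is an equivalence relation with two classes is the parity law
  \<open>parity_generators\<close>. If \<open>A\<close> and \<open>A'\<close> meet in a hyperplane \<open>K\<close> of both, they contain all singular
  vectors of \<open>K\<^sup>\<bottom>\<close>, so replacing \<open>A\<close> by \<open>A'\<close> changes the dimension of the intersection with any
  third generator by exactly one; and any two generators are joined by a chain of such steps.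
  Consequently, an isometry preserves the classes as soon as it preserves the class of a single
  generator, and reflections interchange the classes. Products of reflections therefore suffice
  for both transitivity statements.
\<close>

section \<open>Linear algebra over a finite field\<close>

lemma card_subspace:
  fixes U :: "('a::{field,finite} ^ 'm) set"
  assumes "vec.subspace U"
  shows "card U = CARD('a) ^ vec.dim U"
proof -
  have "card (vec.span S) = CARD('a) ^ card S" if "vec.independent S" "finite S" for S :: "('a ^ 'm) set"
    using that(2,1)
  proof (induction S rule: finite_induct)
    case empty
    then show ?case by simp
  next
    case (insert x S)
    have x: "x \<notin> vec.span S" and S: "vec.independent S"
      using insert.prems insert.hyps vec.independent_insert by metis+
    define h where "h = (\<lambda>(k, u). k *s x + u)"
    have "inj_on h (UNIV \<times> vec.span S)"
    proof (rule inj_onI, clarsimp simp: h_def)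
      fix k l u v assume uv: "u \<in> vec.span S" "v \<in> vec.span S" and eq: "k *s x + u = l *s x + v"
      have "(k - l) *s x = v - u" using eq by (simp add: vec.scale_left_diff_distrib algebra_simps)
      then have "(k - l) *s x \<in> vec.span S" using uv by (simp add: vec.span_diff)
      then have "k = l"
        using x vec.span_scale[of "(k - l) *s x" S "inverse (k - l)"] by (cases "k = l") auto
      then show "k = l \<and> u = v" using eq by simp
    qed
    moreover have "h ` (UNIV \<times> vec.span S) = vec.span (insert x S)"
    proof
      show "h ` (UNIV \<times> vec.span S) \<subseteq> vec.span (insert x S)"
        using vec.span_mono[OF subset_insertI, of S x]
        by (auto simp: h_def intro!: vec.span_add vec.span_scale vec.span_base[of x "insert x S"])
      show "vec.span (insert x S) \<subseteq> h ` (UNIV \<times> vec.span S)"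
      proof
        fix y assume "y \<in> vec.span (insert x S)"
        then obtain k where "y - k *s x \<in> vec.span S" unfolding vec.span_insert by blast
        then have "y = h (k, y - k *s x)" "(k, y - k *s x) \<in> UNIV \<times> vec.span S" by (auto simp: h_def)
        then show "y \<in> h ` (UNIV \<times> vec.span S)" by blast
      qed
    qed
    ultimately have "card (vec.span (insert x S)) = card ((UNIV :: 'a set) \<times> vec.span S)"
      by (metis card_image)
    then show ?case using insert.IH[OF S] insert.hyps by (simp add: card_cartesian_product)
  qed
  moreover obtain S where "S \<subseteq> U" "vec.independent S" "U \<subseteq> vec.span S" "card S = vec.dim U"
    using vec.basis_exists by metis
  moreover have "vec.span S = U"
    using calculation(2,4) assms by (simp add: subset_antisym vec.span_minimal)
  ultimately show ?thesis by (metis finite)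
qed

section \<open>Orthogonality in a hyperbolic space\<close>

locale hyperbolic_space =
  fixes Q :: "'a::{field,finite} ^ 'm \<Rightarrow> 'a" and n q :: nat
  assumes hyperbolic: "hyperbolic_form n Q"
    and rank_ge_2: "2 \<le> n"
    and card_field: "q = CARD('a)"
begin

abbreviation B where "B \<equiv> polar_form Q"

lemma Q_scale: "Q (c *s x) = c\<^sup>2 * Q x"
  using hyperbolic by (auto simp: hyperbolic_form_def quadratic_form_def)

lemma Q_zero [simp]: "Q 0 = 0"
  using Q_scale[of 0 0] by simp

lemma Q_add: "Q (x + y) = Q x + Q y + B x y"
  by (simp add: polar_form_def)

lemma B_commute: "B x y = B y x"
  by (simp add: polar_form_def add.commute)

lemma linear_B: "Vector_Spaces.linear (*s) (*) (B x)"
  using hyperbolic by (simp add: hyperbolic_form_def quadratic_form_def)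

lemma B_add: "B x (y + z) = B x y + B x z" "B (y + z) x = B y x + B z x"
  using linear_B[of x] by (auto simp: Vector_Spaces.linear_iff B_commute[of _ x])

lemma B_scale: "B x (c *s y) = c * B x y" "B (c *s y) x = c * B y x"
  using linear_B[of x] by (auto simp: Vector_Spaces.linear_iff B_commute[of _ x])

lemma B_zero [simp]: "B x 0 = 0" "B 0 x = 0"
  using B_scale(1)[of x 0 0] B_scale(2)[of 0 0 x] by auto

lemma B_diff: "B x (y - z) = B x y - B x z" "B (y - z) x = B y x - B z x"
  using B_add(1)[of x "y - z" z] B_add(2)[of "y - z" z x] by auto

lemma B_self: "B x x = 2 * Q x"
  using Q_scale[of 2 x] by (simp add: polar_form_def vec.scale_left_distrib[of 1 1, simplified])

lemma Q_diff: "Q (x - y) = Q x + Q y - B x y"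
  using Q_add[of "x - y" y] B_diff(2)[of x y y] by (simp add: B_self algebra_simps)

definition perp :: "('a ^ 'm) set \<Rightarrow> ('a ^ 'm) set" where
  "perp U = {y. \<forall>u\<in>U. B u y = 0}"

lemma subset_perp_singleton: "U \<subseteq> perp {x} \<longleftrightarrow> x \<in> perp U"
  unfolding perp_def using B_commute by fastforce

lemma subspace_perp: "vec.subspace (perp U)"
  by (auto simp: perp_def vec.subspace_def B_add B_scale)

lemma perp_span: "perp (vec.span U) = perp U"
proof
  show "perp U \<subseteq> perp (vec.span U)"
  proof
    fix y assume y: "y \<in> perp U"
    have "vec.subspace {u. B u y = 0}" by (auto simp: vec.subspace_def B_add B_scale)
    moreover have "U \<subseteq> {u. B u y = 0}" using y by (auto simp: perp_def)
    ultimately have "vec.span U \<subseteq> {u. B u y = 0}" by (rule vec.span_minimal[rotated])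
    then show "y \<in> perp (vec.span U)" by (auto simp: perp_def)
  qed
qed (auto simp: perp_def vec.span_base)

lemma dim_le_Suc_Int_hyperplane:
  assumes "vec.subspace A"
  shows "vec.dim A \<le> Suc (vec.dim (A \<inter> perp {x}))"
proof (cases "A \<subseteq> perp {x}")
  case True
  then show ?thesis by (simp add: Int_absorb2)
next
  case False
  then obtain a where a: "a \<in> A" "B x a \<noteq> 0" by (auto simp: perp_def)
  have "A \<subseteq> vec.span (insert a (A \<inter> perp {x}))"
  proof
    fix y assume y: "y \<in> A"
    have "B x (y - (B x y / B x a) *s a) = 0" using a by (simp add: B_diff B_scale)
    then have "y - (B x y / B x a) *s a \<in> A \<inter> perp {x}"
      using y a assms by (auto simp: perp_def vec.subspace_diff vec.subspace_scale)
    then show "y \<in> vec.span (insert a (A \<inter> perp {x}))"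
      unfolding vec.span_insert by (blast intro: vec.span_base)
  qed
  then have "vec.dim A \<le> vec.dim (insert a (A \<inter> perp {x}))"
    by (rule vec.dim_mono)
  also have "\<dots> \<le> Suc (vec.dim (A \<inter> perp {x}))" by (simp add: vec.dim_insert)
  finally show ?thesis .
qed

lemma dim_le_Int_perp:
  assumes "vec.subspace A"
  shows "vec.dim A \<le> vec.dim (A \<inter> perp U) + vec.dim U"
proof -
  obtain S where S: "S \<subseteq> U" "U \<subseteq> vec.span S" "card S = vec.dim U"
    using vec.basis_exists by metis
  have "vec.dim A \<le> vec.dim (A \<inter> perp S) + card S"
    using finite[of S]
  proof (induction S rule: finite_induct)
    case empty
    then show ?case by (simp add: perp_def)
  next
    case (insert x S)
    have "A \<inter> perp (insert x S) = (A \<inter> perp S) \<inter> perp {x}" by (auto simp: perp_def)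
    moreover have "vec.subspace (A \<inter> perp S)" by (simp add: assms subspace_perp vec.subspace_inter)
    ultimately show ?case using dim_le_Suc_Int_hyperplane[of "A \<inter> perp S" x] insert by simp
  qed
  moreover have "perp S = perp U"
  proof
    show "perp U \<subseteq> perp S" using S by (auto simp: perp_def)
    have "perp (vec.span S) \<subseteq> perp U" using S by (auto simp: perp_def)
    then show "perp S \<subseteq> perp U" by (simp add: perp_span)
  qed
  ultimately show ?thesis using S by simp
qed

lemma dim_UNIV: "vec.dim (UNIV :: ('a ^ 'm) set) = 2 * n"
  using hyperbolic by (simp add: hyperbolic_form_def card_cart_basis)

text \<open>The lower bound for the dimension of \<open>U\<^sup>\<bottom>\<close> holds for every
  bilinear form. For the upper bound, take a complement \<open>W\<close> of
  \<open>U\<^sup>\<bottom>\<close>: a vector of \<open>U\<close> orthogonal to \<open>W\<close> is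
  orthogonal to everything, so \<open>W\<close> has at least the dimension of \<open>U\<close>. The
  hypothesis on the radical is stated for \<open>U\<close> only, because the lemma is first applied to a
  generator in order to show that the radical is trivial.\<close>

lemma dim_perp_aux:
  assumes U: "vec.subspace U" and triv: "U \<inter> perp UNIV \<subseteq> {0}"
  shows "vec.dim U + vec.dim (perp U) = 2 * n"
proof -
  have "2 * n \<le> vec.dim (perp U) + vec.dim U"
    using dim_le_Int_perp[OF vec.subspace_UNIV, of U] dim_UNIV by simp
  moreover have "vec.dim U \<le> 2 * n - vec.dim (perp U)"
  proof -
    obtain S where S: "S \<subseteq> perp U" "vec.independent S" "perp U \<subseteq> vec.span S" "card S = vec.dim (perp U)"
      using vec.basis_exists by metis
    obtain T where T: "S \<subseteq> T" "vec.independent T" "UNIV \<subseteq> vec.span T"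
      using vec.maximal_independent_subset_extend[OF subset_UNIV S(2)] by metis
    have cT: "card T = 2 * n"
      using vec.basis_card_eq_dim[OF subset_UNIV T(3,2)] dim_UNIV by simp
    have "U \<inter> perp (T - S) \<subseteq> {0}"
    proof
      fix u assume u: "u \<in> U \<inter> perp (T - S)"
      have "u \<in> perp T"
        using u S(1) T(1) by (auto simp: perp_def B_commute[of _ u])
      then have "u \<in> perp UNIV" using perp_span[of T] T(3) top.extremum_unique by metis
      then show "u \<in> {0}" using u triv by auto
    qed
    then have "vec.dim (U \<inter> perp (T - S)) = 0" by (simp only: vec.dim_eq_0)
    then have "vec.dim U \<le> vec.dim (T - S)" using dim_le_Int_perp[OF U, of "T - S"] by linarith
    also have "\<dots> \<le> card (T - S)" by (simp add: vec.dim_le_card vec.span_superset)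
    also have "\<dots> = 2 * n - vec.dim (perp U)" using cT S(4) T(1) by (simp add: card_Diff_subset)
    finally show ?thesis .
  qed
  moreover have "vec.dim (perp U) \<le> 2 * n" using vec.dim_subset[of "perp U" UNIV] dim_UNIV by simp
  ultimately show ?thesis by linarith
qed

lemma singular_subspace_perp:
  assumes "totally_singular Q U" shows "U \<subseteq> perp U"
  using assms by (auto simp: totally_singular_def perp_def polar_form_def vec.subspace_add)

text \<open>Nondegeneracy of \<open>Q\<close> only excludes nonzero singular vectors from the radical of
  its polar form; in characteristic 2 and odd dimension that radical is never trivial. Here a generator
  \<open>N\<close>, of half the dimension, forces it to vanish: \<open>N\<close> meets it trivially,
  hence \<open>N\<^sup>\<bottom> = N\<close>, and \<open>N\<^sup>\<bottom>\<close> contains the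
  radical.\<close>

lemma perp_UNIV: "perp UNIV = {0}"
proof -
  obtain N where N: "generator n Q N" using hyperbolic by (auto simp: hyperbolic_form_def)
  then have sN: "vec.subspace N" and tN: "totally_singular Q N" by (auto simp: generator_def totally_singular_def)
  have nd: "x = 0" if "Q x = 0" "x \<in> perp UNIV" for x
    using hyperbolic that by (auto simp: hyperbolic_form_def nondegenerate_def perp_def B_commute[of _ x])
  have "N \<inter> perp UNIV \<subseteq> {0}"
    using nd tN by (auto simp: totally_singular_def)
  then have "vec.dim (perp N) = n" using dim_perp_aux[OF sN] N by (simp add: generator_def)
  then have "N = perp N"
    using singular_subspace_perp[OF tN] sN N
    by (intro vec.subspace_dim_equal) (auto simp: subspace_perp generator_def)
  moreover have "perp UNIV \<subseteq> perp N" by (auto simp: perp_def)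
  ultimately show ?thesis using nd tN subspace_perp[of UNIV] by (auto simp: totally_singular_def vec.subspace_0)
qed

lemma dim_perp: "vec.subspace U \<Longrightarrow> vec.dim U + vec.dim (perp U) = 2 * n"
  using dim_perp_aux perp_UNIV by blast

lemma nonorthogonal_exists: "x \<noteq> 0 \<Longrightarrow> \<exists>y. B x y \<noteq> 0"
  using perp_UNIV by (auto simp: perp_def B_commute[of _ x])

lemma dim_singular_le: "totally_singular Q U \<Longrightarrow> vec.dim U \<le> n"
  using dim_perp[of U] singular_subspace_perp[of U] vec.dim_subset[of U "perp U"]
  by (auto simp: totally_singular_def)

lemma generatorD:
  assumes "generator n Q N"
  shows "vec.subspace N" "totally_singular Q N" "vec.dim N = n" "\<And>x. x \<in> N \<Longrightarrow> Q x = 0"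
  using assms by (auto simp: generator_def totally_singular_def)

lemma perp_generator:
  assumes "generator n Q N" shows "perp N = N"
  using generatorD[OF assms] dim_perp[of N] singular_subspace_perp[of N] subspace_perp[of N]
  by (intro vec.subspace_dim_equal[symmetric]) auto

lemma generator_eqI:
  assumes "generator n Q A" "generator n Q C" "vec.dim (A \<inter> C) = n" shows "A = C"
proof -
  have "A \<inter> C = A" "A \<inter> C = C"
    using assms vec.subspace_dim_equal[of "A \<inter> C" A] vec.subspace_dim_equal[of "A \<inter> C" C]
    by (auto simp: generator_def totally_singular_def vec.subspace_inter)
  then show ?thesis by simp
qed

lemma totally_singular_insert:
  assumes U: "totally_singular Q U" and x: "Q x = 0" "x \<in> perp U"
  shows "totally_singular Q (vec.span (insert x U))"
  unfolding totally_singular_def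
proof (intro conjI ballI)
  fix y assume "y \<in> vec.span (insert x U)"
  then obtain k where k: "y - k *s x \<in> U"
    using U unfolding vec.span_insert by (auto simp: totally_singular_def vec.span_eq_iff[THEN iffD2])
  have "Q ((y - k *s x) + k *s x) = 0"
    using k U x unfolding Q_add by (auto simp: totally_singular_def Q_scale B_scale perp_def)
  then show "Q y = 0" by simp
qed simp

lemma dim_span_insert:
  assumes "vec.subspace U" "x \<notin> U"
  shows "vec.dim (vec.span (insert x U)) = Suc (vec.dim U)"
  using assms by (simp add: vec.dim_insert vec.span_eq_iff[THEN iffD2])


section \<open>The two classes of generators\<close>

text \<open>Modulo \<open>K = A \<inter> C\<close>, the space \<open>K\<^sup>\<bottom>\<close> is a hyperbolic plane, whose only singular points are the
  two coming from \<open>A\<close> and \<open>C\<close>. Concretely, \<open>K\<^sup>\<bottom>\<close> is spanned by \<open>A\<close> and one vector \<open>c\<close> of \<open>C\<close>, and a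
  singular vector \<open>a + k c\<close> with \<open>k \<noteq> 0\<close> has \<open>a\<close> orthogonal to \<open>C\<close>.\<close>

lemma singular_perp_hyperplane:
  assumes A: "generator n Q A" and C: "generator n Q C"
    and K: "Suc (vec.dim (A \<inter> C)) = n"
    and x: "Q x = 0" "x \<in> perp (A \<inter> C)"
  shows "x \<in> A \<union> C"
proof (rule ccontr)
  assume nx: "x \<notin> A \<union> C"
  note sA = generatorD[OF A] and sC = generatorD[OF C]
  have sK: "vec.subspace (A \<inter> C)" using sA sC by (simp add: vec.subspace_inter)
  have "\<not> C \<subseteq> A" using K sC by (auto simp: Int_absorb1)
  then obtain c where c: "c \<in> C" "c \<notin> A" by blast
  have "vec.span (insert c A) \<subseteq> perp (A \<inter> C)"
    using singular_subspace_perp[OF sA(2)] singular_subspace_perp[OF sC(2)] c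
    by (intro vec.span_minimal subspace_perp) (auto simp: perp_def)
  then have "vec.span (insert c A) = perp (A \<inter> C)"
    using dim_span_insert[OF sA(1) c(2)] dim_perp[OF sK] K sA(3)
    by (intro vec.subspace_dim_equal) (auto simp: subspace_perp)
  then obtain k where k: "x - k *s c \<in> A"
    using x sA(1) unfolding vec.span_insert by (auto simp: vec.span_eq_iff[THEN iffD2])
  define a where "a = x - k *s c"
  have xa: "x = a + k *s c" and a: "a \<in> A" using k by (auto simp: a_def)
  have "k \<noteq> 0" using nx xa a by auto
  then have Bac: "B a c = 0"
    using x(1) sA(4)[OF a] sC(4)[OF c(1)] by (simp add: xa Q_add Q_scale B_scale)
  have "C = vec.span (insert c (A \<inter> C))"
    using c sC(1,3) dim_span_insert[OF sK, of c] K
    by (intro vec.subspace_dim_equal[symmetric] vec.span_minimal) auto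
  then have "perp C = perp (insert c (A \<inter> C))" using perp_span by metis
  moreover have "a \<in> perp (insert c (A \<inter> C))"
    using Bac a singular_subspace_perp[OF sA(2)] by (auto simp: perp_def B_commute[of _ a])
  ultimately have "a \<in> C" using perp_generator[OF C] by simp
  then have "x \<in> C" using c sC(1) by (simp add: xa vec.subspace_add vec.subspace_scale)
  then show False using nx by simp
qed

text \<open>The left-hand intersection is the orthogonal complement of \<open>M + K\<close>, because
  \<open>M\<^sup>\<bottom> = M\<close>.\<close>

lemma dim_generator_Int_perp:
  assumes M: "generator n Q M" and K: "vec.subspace K"
  shows "vec.dim (M \<inter> perp K) + vec.dim K = n + vec.dim (M \<inter> K)"
proof -
  note sM = generatorD[OF M]
  let ?S = "{x + y |x y. x \<in> M \<and> y \<in> K}"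
  have sS: "vec.subspace ?S" using sM K by (simp add: vec.subspace_sums)
  have "perp ?S = M \<inter> perp K"
  proof
    have "M \<subseteq> ?S" "K \<subseteq> ?S" using vec.subspace_0[OF K] vec.subspace_0[OF sM(1)] by force+
    then have "perp ?S \<subseteq> perp M \<inter> perp K" unfolding perp_def by blast
    then show "perp ?S \<subseteq> M \<inter> perp K" using perp_generator[OF M] by simp
    have "perp M \<inter> perp K \<subseteq> perp ?S" by (auto simp: perp_def B_add)
    then show "M \<inter> perp K \<subseteq> perp ?S" using perp_generator[OF M] by simp
  qed
  moreover have "vec.dim ?S + vec.dim (M \<inter> K) = vec.dim M + vec.dim K"
    by (rule vec.dim_sums_Int[OF sM(1) K])
  ultimately show ?thesis using dim_perp[OF sS] sM(3) by simp
qed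

text \<open>With \<open>K = A \<inter> C\<close>, the space \<open>M \<inter> K\<^sup>\<bottom>\<close>
  exceeds \<open>M \<inter> K\<close> by one dimension and is the union of \<open>A \<inter> M\<close>
  and \<open>C \<inter> M\<close>. A subspace is not the union of two proper subspaces, so one of the
  two is everything and the other one is \<open>M \<inter> K\<close>.\<close>

lemma dim_Int_adjacent:
  assumes A: "generator n Q A" and C: "generator n Q C" and M: "generator n Q M"
    and K: "Suc (vec.dim (A \<inter> C)) = n"
  shows "vec.dim (A \<inter> M) = Suc (vec.dim (C \<inter> M)) \<or> vec.dim (C \<inter> M) = Suc (vec.dim (A \<inter> M))"
proof -
  note sA = generatorD[OF A] and sC = generatorD[OF C] and sM = generatorD[OF M]
  define K' where "K' = A \<inter> C"
  have sK: "vec.subspace K'" using sA sC by (simp add: vec.subspace_inter K'_def)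
  have union: "M \<inter> perp K' = (A \<inter> M) \<union> (C \<inter> M)"
    using singular_perp_hyperplane[OF A C K] sM(4)
      singular_subspace_perp[OF sA(2)] singular_subspace_perp[OF sC(2)]
    by (auto simp: K'_def perp_def)
  have dim: "vec.dim (M \<inter> perp K') = Suc (vec.dim (M \<inter> K'))"
    using dim_generator_Int_perp[OF M sK] K by (simp add: K'_def)
  have "A \<inter> M \<subseteq> C \<inter> M \<or> C \<inter> M \<subseteq> A \<inter> M"
  proof (rule ccontr)
    assume "\<not> ?thesis"
    then obtain x y where x: "x \<in> A \<inter> M" "x \<notin> C \<inter> M" and y: "y \<in> C \<inter> M" "y \<notin> A \<inter> M" by blast
    then have "x + y \<in> (A \<inter> M) \<union> (C \<inter> M)"
      using union sM(1) subspace_perp[of K'] by (metis IntE IntI UnI1 UnI2 vec.subspace_add)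
    then show False
      using x y vec.subspace_diff[OF sA(1), of "x + y" x] vec.subspace_diff[OF sC(1), of "x + y" y]
      by auto
  qed
  then show ?thesis
  proof
    assume "A \<inter> M \<subseteq> C \<inter> M"
    then have "M \<inter> perp K' = C \<inter> M" "M \<inter> K' = A \<inter> M" using union by (auto simp: K'_def)
    then show ?thesis using dim by simp
  next
    assume "C \<inter> M \<subseteq> A \<inter> M"
    then have "M \<inter> perp K' = A \<inter> M" "M \<inter> K' = C \<inter> M" using union by (auto simp: K'_def)
    then show ?thesis using dim by simp
  qed
qed

text \<open>For \<open>c\<close> in \<open>C\<close> but not in \<open>A\<close>, the generator spanned
  by \<open>c\<close> and \<open>A \<inter> c\<^sup>\<bottom>\<close> is the neighbour of
  \<open>A\<close> on \<open>c\<close>; it keeps \<open>A \<inter> C\<close>.\<close>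

lemma generator_closer:
  assumes A: "generator n Q A" and C: "generator n Q C" and "A \<noteq> C"
  obtains A' where "generator n Q A'" "Suc (vec.dim (A \<inter> A')) = n"
    "vec.dim (A' \<inter> C) = Suc (vec.dim (A \<inter> C))"
proof -
  note sA = generatorD[OF A] and sC = generatorD[OF C]
  have "\<not> C \<subseteq> A"
    using assms(3) vec.subspace_dim_equal[OF sC(1) sA(1)] sA sC by auto
  then obtain c where c: "c \<in> C" "c \<notin> A" by blast
  define H where "H = A \<inter> perp {c}"
  have sH: "vec.subspace H" using sA by (simp add: H_def vec.subspace_inter subspace_perp)
  have "\<not> A \<subseteq> perp {c}"
  proof
    assume "A \<subseteq> perp {c}"
    then have "c \<in> perp A" by (simp add: subset_perp_singleton)
    then show False using c perp_generator[OF A] by simp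
  qed
  then have "H \<noteq> A" by (auto simp: H_def)
  then have "vec.dim H < n"
    using vec.subspace_dim_equal[OF sH sA(1)] sA(3) by (force simp: H_def)
  then have dH: "Suc (vec.dim H) = n"
    using dim_le_Suc_Int_hyperplane[OF sA(1), of c] sA(3) by (simp add: H_def)
  have tH: "totally_singular Q H" using sH sA(4) by (auto simp: totally_singular_def H_def)
  have "c \<notin> H" using c by (simp add: H_def)
  moreover have "c \<in> perp H" by (simp add: H_def flip: subset_perp_singleton)
  ultimately have cH: "c \<in> perp H" "c \<notin> H" by blast+
  define A' where "A' = vec.span (insert c H)"
  have gA': "generator n Q A'"
    unfolding A'_def generator_def
    using totally_singular_insert[OF tH sC(4)[OF c(1)] cH(1)] dim_span_insert[OF sH cH(2)] dH by simp
  have inA': "c \<in> A'" "H \<subseteq> A'" by (auto simp: A'_def vec.span_base)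
  have "A \<noteq> A'" using inA' c by auto
  then have "vec.dim (A \<inter> A') \<noteq> n" using generator_eqI[OF A gA'] by blast
  moreover have "vec.dim H \<le> vec.dim (A \<inter> A')"
    using inA' by (intro vec.dim_subset) (auto simp: H_def)
  moreover have "vec.dim (A \<inter> A') \<le> n" using vec.dim_subset[of "A \<inter> A'" A] sA(3) by simp
  ultimately have adj: "Suc (vec.dim (A \<inter> A')) = n" using dH by linarith
  have "A \<inter> C \<subseteq> H" using singular_subspace_perp[OF sC(2)] c by (auto simp: H_def perp_def)
  then have sub: "A \<inter> C \<subseteq> A' \<inter> C" using inA' by blast
  then have "vec.dim (A \<inter> C) \<le> vec.dim (A' \<inter> C)" by (rule vec.dim_subset)
  then have "vec.dim (A' \<inter> C) = Suc (vec.dim (A \<inter> C))"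
    using dim_Int_adjacent[OF A gA' C adj] by linarith
  then show ?thesis using that gA' adj by blast
qed

text \<open>Walk from \<open>A\<close> to \<open>C\<close> through neighbours. Each step changes exactly
  two of the three dimensions, each by one; at the end the generators \<open>A\<close> and
  \<open>C\<close> are equal, and the sum is clearly even.\<close>

lemma parity_generators:
  assumes "generator n Q A" "generator n Q M" "generator n Q C"
  shows "even (vec.dim (A \<inter> M) + vec.dim (M \<inter> C) + vec.dim (A \<inter> C) + n)"
  using assms
proof (induction "n - vec.dim (A \<inter> C)" arbitrary: A)
  case 0
  then have "vec.dim (A \<inter> C) = n"
    using vec.dim_subset[of "A \<inter> C" A] generatorD(3)[OF 0(2)] by simp
  then have "A = C" using generator_eqI 0 by blast
  then show ?case using generatorD(3)[OF 0(2)] by (simp add: Int_commute)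
next
  case (Suc k)
  then have "A \<noteq> C" by (auto simp: generator_def)
  then obtain A' where A': "generator n Q A'" "Suc (vec.dim (A \<inter> A')) = n"
    "vec.dim (A' \<inter> C) = Suc (vec.dim (A \<inter> C))"
    using generator_closer Suc.prems by metis
  have "even (vec.dim (A' \<inter> M) + vec.dim (M \<inter> C) + vec.dim (A' \<inter> C) + n)"
    using Suc.hyps(1)[of A'] Suc.hyps(2) A' Suc.prems by simp
  then show ?case
    using dim_Int_adjacent[OF Suc.prems(1) A'(1) Suc.prems(2) A'(2)] A'(3) by auto
qed

lemma same_class_iff_even: "same_class n A C \<longleftrightarrow> even (vec.dim (A \<inter> C) + n)"
  unfolding same_class_def by (simp add: even_add mod2_eq_if)

lemma same_class_sym: "same_class n A C \<Longrightarrow> same_class n C A"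
  by (simp add: same_class_def Int_commute)

text \<open>This is how the parity law is used below: it contains transitivity of
  \<open>same_class\<close>, and also that there are at most two classes.\<close>

lemma same_class_triangle:
  assumes "generator n Q A" "generator n Q M" "generator n Q C"
  shows "same_class n A C \<longleftrightarrow> (same_class n A M \<longleftrightarrow> same_class n M C)"
  using parity_generators[OF assms] unfolding same_class_iff_even by auto

section \<open>Isometries and transitivity\<close>

definition isometry :: "('a ^ 'm \<Rightarrow> 'a ^ 'm) \<Rightarrow> bool" where
  "isometry f \<longleftrightarrow> Vector_Spaces.linear (*s) (*s) f \<and> (\<forall>x. Q (f x) = Q x)"

lemma isometry_id: "isometry id"
  by (simp add: isometry_def vec.linear_id)

lemma isometry_comp: "isometry f \<Longrightarrow> isometry g \<Longrightarrow> isometry (f \<circ> g)"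
  by (auto simp: isometry_def intro: Vector_Spaces.linear_compose)

lemma isometry_B: "isometry f \<Longrightarrow> B (f x) (f y) = B x y"
  by (simp add: isometry_def polar_form_def) (metis Vector_Spaces.linear_iff)

lemma isometry_inj: assumes "isometry f" shows "inj f"
proof -
  have "x = 0" if "f x = 0" for x
  proof (rule ccontr)
    assume "x \<noteq> 0"
    then obtain y where "B x y \<noteq> 0" using nonorthogonal_exists by blast
    then show False using isometry_B[OF assms, of x y] that by simp
  qed
  moreover have "f (x - y) = f x - f y" for x y
    using assms Vector_Spaces.linear.axioms(3)[of "(*s)" "(*s)" f] module_hom.diff unfolding isometry_def by blast
  ultimately have "x = y" if "f x = f y" for x y using that by (metis diff_self eq_iff_diff_eq_0)
  then show ?thesis by (rule injI)
qed

lemma dim_isometry: "isometry f \<Longrightarrow> vec.dim (f ` U) = vec.dim U"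
  using isometry_inj[of f] vec.dim_image_eq[of f U] by (auto simp: isometry_def intro: inj_on_subset)

lemma totally_singular_isometry: "isometry f \<Longrightarrow> totally_singular Q U \<Longrightarrow> totally_singular Q (f ` U)"
  by (auto simp: totally_singular_def isometry_def intro: vec.linear_subspace_image)

lemma generator_isometry: "isometry f \<Longrightarrow> generator n Q N \<Longrightarrow> generator n Q (f ` N)"
  by (simp add: generator_def totally_singular_isometry dim_isometry)

definition class_preserving :: "('a ^ 'm \<Rightarrow> 'a ^ 'm) \<Rightarrow> bool" where
  "class_preserving f \<longleftrightarrow> (\<forall>N. generator n Q N \<longrightarrow> same_class n N (f ` N))"

text \<open>An isometry permutes the two classes, so it either preserves or interchanges them, and one
  generator decides which.\<close>

lemma class_preserving_if_one:
  assumes f: "isometry f" and N: "generator n Q N" "same_class n N (f ` N)"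
  shows "class_preserving f"
  unfolding class_preserving_def
proof (intro allI impI)
  fix M assume M: "generator n Q M"
  note gf = generator_isometry[OF f]
  have "f ` N \<inter> f ` M = f ` (N \<inter> M)" using isometry_inj[OF f] by (simp add: image_Int)
  then have "same_class n (f ` N) (f ` M) \<longleftrightarrow> same_class n N M"
    by (simp add: same_class_def dim_isometry[OF f])
  then show "same_class n M (f ` M)"
    using same_class_triangle[OF M N(1) gf[OF M]] same_class_triangle[OF N(1) gf[OF N(1)] gf[OF M]]
      N(2) same_class_sym by blast
qed

definition reflection :: "'a ^ 'm \<Rightarrow> 'a ^ 'm \<Rightarrow> 'a ^ 'm" where
  "reflection a x = x - (B a x / Q a) *s a"

lemma isometry_reflection: assumes "Q a \<noteq> 0" shows "isometry (reflection a)"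
  unfolding isometry_def
proof
  show "Vector_Spaces.linear (*s) (*s) (reflection a)"
    unfolding Vector_Spaces.linear_iff
    by (auto simp: reflection_def vec.vector_space_axioms B_add B_scale add_divide_distrib
        vec.scale_left_distrib vec.scale_right_diff_distrib algebra_simps)
  show "\<forall>x. Q (reflection a x) = Q x"
    using assms by (auto simp: reflection_def Q_diff Q_scale B_scale B_commute[of _ a] power2_eq_square)
qed

lemma reflection_orthogonal: "B a x = 0 \<Longrightarrow> reflection a x = x"
  by (simp add: reflection_def)

text \<open>For singular \<open>x\<close> and \<open>y\<close> one has \<open>Q (x - y) = - B x
  y\<close>, so the reflection in \<open>x - y\<close> is available exactly if \<open>x\<close> and
  \<open>y\<close> are not orthogonal.\<close>

lemma reflection_maps:
  assumes "Q x = 0" "Q y = 0" "B x y \<noteq> 0"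
  shows "Q (x - y) \<noteq> 0" "reflection (x - y) x = y"
proof -
  have q: "Q (x - y) = - B x y" using assms by (simp add: Q_diff)
  then show "Q (x - y) \<noteq> 0" using assms by simp
  show "reflection (x - y) x = y"
    using assms by (simp add: reflection_def q B_diff B_self B_commute[of y])
qed

text \<open>The reflection fixes the hyperplane \<open>N \<inter> a\<^sup>\<bottom>\<close> of
  \<open>N\<close> and moves every other vector of \<open>N\<close> by a nonzero multiple of the
  nonsingular vector \<open>a\<close>, hence out of \<open>N\<close>.\<close>

lemma reflection_changes_class:
  assumes a: "Q a \<noteq> 0" and N: "generator n Q N"
  shows "\<not> same_class n N (reflection a ` N)"
proof -
  note sN = generatorD[OF N]
  have gN: "generator n Q (reflection a ` N)" by (simp add: generator_isometry isometry_reflection a N)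
  have "a \<notin> N" using a sN(4) by auto
  have "N \<inter> reflection a ` N = N \<inter> perp {a}"
  proof
    show "N \<inter> perp {a} \<subseteq> N \<inter> reflection a ` N"
    proof
      fix x assume "x \<in> N \<inter> perp {a}"
      then have "x \<in> N" "reflection a x = x" by (auto simp: perp_def reflection_orthogonal)
      then show "x \<in> N \<inter> reflection a ` N" by (metis IntI imageI)
    qed
    show "N \<inter> reflection a ` N \<subseteq> N \<inter> perp {a}"
    proof
      fix y assume "y \<in> N \<inter> reflection a ` N"
      then obtain x where x: "x \<in> N" "y = reflection a x" "y \<in> N" by auto
      then have "x - y \<in> N" using sN(1) by (simp add: vec.subspace_diff)
      then have "(B a x / Q a) *s a \<in> N" by (simp add: x reflection_def)
      then have "B a x / Q a = 0"
        using \<open>a \<notin> N\<close> vec.subspace_scale[OF sN(1), of "(B a x / Q a) *s a" "inverse (B a x / Q a)"]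
        by (cases "B a x / Q a = 0") auto
      then have "B a x = 0" using a by simp
      then show "y \<in> N \<inter> perp {a}" using x by (simp add: reflection_orthogonal perp_def)
    qed
  qed
  moreover have "\<not> N \<subseteq> perp {a}"
  proof
    assume "N \<subseteq> perp {a}"
    then have "a \<in> perp N" by (simp add: subset_perp_singleton)
    then show False using \<open>a \<notin> N\<close> perp_generator[OF N] by simp
  qed
  ultimately have "N \<noteq> reflection a ` N" by auto
  then have "vec.dim (N \<inter> reflection a ` N) \<noteq> n" using generator_eqI[OF N gN] by blast
  moreover have "vec.dim (N \<inter> reflection a ` N) \<le> n"
    using vec.dim_subset[of "N \<inter> reflection a ` N" N] sN(3) by simp
  moreover have "n \<le> Suc (vec.dim (N \<inter> reflection a ` N))"
    using dim_le_Suc_Int_hyperplane[OF sN(1), of a] sN(3)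
    by (simp add: \<open>N \<inter> reflection a ` N = N \<inter> perp {a}\<close>)
  ultimately have "n = Suc (vec.dim (N \<inter> reflection a ` N))" by linarith
  then show ?thesis unfolding same_class_iff_even by presburger
qed

text \<open>For \<open>x\<close> in \<open>A\<close> but not in \<open>C\<close>, and \<open>y\<close>
  in \<open>C\<close> not orthogonal to \<open>x\<close>, the reflection taking \<open>x\<close> to
  \<open>y\<close> fixes \<open>A \<inter> C\<close> pointwise, so it brings \<open>A\<close> closer to
  \<open>C\<close>.\<close>

lemma isometry_transitive_generators:
  assumes "generator n Q A" "generator n Q C"
  shows "\<exists>f. isometry f \<and> f ` A = C"
  using assms
proof (induction "n - vec.dim (A \<inter> C)" arbitrary: A rule: less_induct)
  case less
  note sA = generatorD[OF less.prems(1)] and sC = generatorD[OF less.prems(2)]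
  show ?case
  proof (cases "A = C")
    case True
    then show ?thesis by (intro exI[of _ id]) (simp add: isometry_id)
  next
    case False
    then have "\<not> A \<subseteq> C" using vec.subspace_dim_equal[OF sA(1) sC(1)] sA sC by auto
    then obtain x where x: "x \<in> A" "x \<notin> C" by blast
    then have "x \<notin> perp C" using perp_generator[OF less.prems(2)] by simp
    then obtain y where y: "y \<in> C" "B x y \<noteq> 0" unfolding perp_def using B_commute by fastforce
    define r where "r = reflection (x - y)"
    have r: "isometry r" "r x = y"
      using reflection_maps[OF sA(4)[OF x(1)] sC(4)[OF y(1)] y(2)] by (auto simp: r_def isometry_reflection)
    have gr: "generator n Q (r ` A)" using r less.prems by (simp add: generator_isometry)
    have fix_meet: "r z = z" if "z \<in> A \<inter> C" for z
    proof -
      have "B x z = 0" "B y z = 0"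
        using that x y singular_subspace_perp[OF sA(2)] singular_subspace_perp[OF sC(2)]
        unfolding perp_def by blast+
      then show ?thesis by (simp add: r_def reflection_orthogonal B_diff)
    qed
    have "A \<inter> C \<subseteq> r ` A \<inter> C" using fix_meet by force
    moreover have "y \<in> r ` A \<inter> C" using x y r by auto
    moreover have "y \<notin> A" using y x singular_subspace_perp[OF sA(2)] by (auto simp: perp_def)
    ultimately have "A \<inter> C \<subset> r ` A \<inter> C" by auto
    moreover have "vec.subspace (A \<inter> C)" "vec.subspace (r ` A \<inter> C)"
      using sA(1) sC(1) generatorD(1)[OF gr] by (auto simp: vec.subspace_inter)
    ultimately have "vec.dim (A \<inter> C) < vec.dim (r ` A \<inter> C)"
      by (metis vec.dim_psubset vec.span_eq_iff)
    moreover have "vec.dim (r ` A \<inter> C) \<le> n"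
      using vec.dim_subset[of "r ` A \<inter> C" C] sC(3) by simp
    ultimately have "n - vec.dim (r ` A \<inter> C) < n - vec.dim (A \<inter> C)" by linarith
    then have "\<exists>f. isometry f \<and> f ` (r ` A) = C" by (rule less.hyps[OF _ gr less.prems(2)])
    then obtain f where "isometry f" "f ` (r ` A) = C" by blast
    then show ?thesis using r isometry_comp by (metis image_comp)
  qed
qed

lemma class_preserving_transitive_generators:
  assumes "generator n Q A" "generator n Q C" "same_class n A C"
  obtains f where "isometry f" "class_preserving f" "f ` A = C"
  using isometry_transitive_generators[OF assms(1,2)] class_preserving_if_one assms by metis

lemma common_nonorthogonal:
  assumes "x \<noteq> 0" "y \<noteq> 0" shows "\<exists>w. B x w \<noteq> 0 \<and> B y w \<noteq> 0"
proof -
  obtain u v where uv: "B x u \<noteq> 0" "B y v \<noteq> 0" using nonorthogonal_exists assms by blast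
  show ?thesis
  proof (cases "B y u = 0 \<and> B x v = 0")
    case True
    then have "B x (u + v) \<noteq> 0 \<and> B y (u + v) \<noteq> 0" using uv by (simp add: B_add)
    then show ?thesis by blast
  qed (use uv in blast)
qed

lemma isometry_transitive_singular_vectors:
  assumes "x \<noteq> 0" "y \<noteq> 0" "Q x = 0" "Q y = 0"
  shows "\<exists>f. isometry f \<and> f x = y"
proof -
  have step: "\<exists>f. isometry f \<and> f u = v" if "Q u = 0" "Q v = 0" "B u v \<noteq> 0" for u v
    using reflection_maps[OF that] isometry_reflection by blast
  show ?thesis
  proof (cases "B x y = 0")
    case True
    obtain w where w: "B x w \<noteq> 0" "B y w \<noteq> 0" using common_nonorthogonal assms by blast
    \<comment> \<open>moving along \<open>x\<close> makes \<open>w\<close> singular and changes neither of its products with \<open>x\<close> and \<open>y\<close>\<close>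
    define z where "z = w - (Q w / B x w) *s x"
    have "Q z = 0" "B x z \<noteq> 0" "B z y \<noteq> 0"
      using w assms True
      by (auto simp: z_def Q_diff Q_scale B_diff B_scale B_self B_commute[of y x] B_commute[of w] )
    then obtain f g where "isometry f" "f x = z" "isometry g" "g z = y"
      using step assms by metis
    then have "isometry (g \<circ> f) \<and> (g \<circ> f) x = y" by (simp add: isometry_comp)
    then show ?thesis by blast
  qed (use step assms in blast)
qed

text \<open>If an isometry taking \<open>x\<close> to \<open>y\<close> interchanges the classes, follow
  it by a reflection that fixes \<open>y\<close>. Its centre is a nonsingular vector orthogonal to
  \<open>y\<close>, and exists since \<open>y\<^sup>\<bottom>\<close> is too large to be totally
  singular.\<close>

lemma class_preserving_transitive_singular_vectors:
  assumes "x \<noteq> 0" "y \<noteq> 0" "Q x = 0" "Q y = 0"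
  obtains f where "isometry f" "class_preserving f" "f x = y"
proof -
  obtain f where f: "isometry f" "f x = y" using isometry_transitive_singular_vectors assms by blast
  obtain N where N: "generator n Q N" using hyperbolic by (auto simp: hyperbolic_form_def)
  note gf = generator_isometry[OF f(1) N]
  show thesis
  proof (cases "same_class n N (f ` N)")
    case True
    then show ?thesis using that f N class_preserving_if_one by blast
  next
    case False
    have "vec.dim (perp {y}) \<noteq> n \<and> \<not> vec.dim (perp {y}) \<le> n"
      using dim_perp[of "vec.span {y}"] assms(2) rank_ge_2 by (auto simp: perp_span)
    then have "\<not> totally_singular Q (perp {y})" using dim_singular_le by blast
    then obtain a where a: "B a y = 0" "Q a \<noteq> 0"
      using subspace_perp B_commute[of y] unfolding totally_singular_def perp_def by fastforce
    define r where "r = reflection a"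
    have r: "isometry r" "r y = y" using a by (auto simp: r_def isometry_reflection reflection_orthogonal)
    have "\<not> same_class n (f ` N) (r ` (f ` N))"
      using reflection_changes_class[OF a(2) gf] by (simp add: r_def)
    then have "same_class n N ((r \<circ> f) ` N)"
      using False same_class_triangle[OF N gf generator_isometry[OF r(1) gf]] by (simp add: image_comp)
    moreover have "isometry (r \<circ> f)" using r f by (simp add: isometry_comp)
    ultimately show ?thesis using that N class_preserving_if_one r f by (metis comp_apply)
  qed
qed

end

section \<open>Counting singular vectors, points and generators\<close>

lemma double_counting:
  assumes "finite X" "finite Y"
  shows "(\<Sum>x\<in>X. card {y \<in> Y. R x y}) = (\<Sum>y\<in>Y. card {x \<in> X. R x y})"
proof -
  have "(\<Sum>x\<in>X. card {y \<in> Y. R x y}) = (\<Sum>x\<in>X. \<Sum>y\<in>Y. if R x y then 1 else 0)"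
    using assms by (simp add: sum.inter_filter[symmetric])
  also have "\<dots> = (\<Sum>y\<in>Y. \<Sum>x\<in>X. if R x y then 1 else 0)" by (rule sum.swap)
  also have "\<dots> = (\<Sum>y\<in>Y. card {x \<in> X. R x y})"
    using assms by (simp add: sum.inter_filter[symmetric])
  finally show ?thesis .
qed

context hyperbolic_space
begin

lemma q_ge_2: "2 \<le> q"
proof -
  have "card {0, 1 :: 'a} \<le> q" unfolding card_field by (rule card_mono) auto
  then show ?thesis by simp
qed

lemma card_subspace_q:
  fixes U :: "('a ^ 'm) set"
  shows "vec.subspace U \<Longrightarrow> card U = q ^ vec.dim U"
  using card_subspace card_field by simp

lemma card_generator: "generator n Q N \<Longrightarrow> card N = q ^ n"
  using generatorD[of N] card_subspace_q[of N] by simp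

text \<open>The level sets of a nonzero linear form on \<open>N\<close> are translates of each
  other.\<close>

lemma card_affine_hyperplane:
  assumes N: "vec.subspace N" and v: "v \<notin> perp N"
  shows "q * card {x \<in> N. B v x = c} = card N"
proof -
  obtain y where y: "y \<in> N" "B v y \<noteq> 0" using v B_commute unfolding perp_def by fastforce
  define z where "z = (1 / B v y) *s y"
  have z: "z \<in> N" "B v z = 1" using y N by (auto simp: z_def vec.subspace_scale B_scale)
  have fib: "card {x \<in> N. B v x = d} = card {x \<in> N. B v x = 0}" for d
  proof -
    have "{x \<in> N. B v x = d} = (\<lambda>x. x + d *s z) ` {x \<in> N. B v x = 0}"
    proof
      show "{x \<in> N. B v x = d} \<subseteq> (\<lambda>x. x + d *s z) ` {x \<in> N. B v x = 0}"
      proof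
        fix x assume "x \<in> {x \<in> N. B v x = d}"
        then have "x - d *s z \<in> {x \<in> N. B v x = 0}"
          using z N by (auto simp: B_diff B_scale vec.subspace_diff vec.subspace_scale)
        then show "x \<in> (\<lambda>x. x + d *s z) ` {x \<in> N. B v x = 0}" by (rule rev_image_eqI) simp
      qed
    qed (use z N in \<open>auto simp: B_add B_scale vec.subspace_add vec.subspace_scale\<close>)
    then show ?thesis by (simp add: card_image inj_on_def)
  qed
  have "card N = card (\<Union>d. {x \<in> N. B v x = d})" by (rule arg_cong[of _ _ card]) auto
  also have "\<dots> = (\<Sum>d\<in>UNIV. card {x \<in> N. B v x = d})" by (rule card_UN_disjoint) auto
  also have "\<dots> = (\<Sum>d\<in>(UNIV :: 'a set). card {x \<in> N. B v x = c})"
    by (rule sum.cong[OF refl]) (rule trans[OF fib fib[symmetric]])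
  finally show ?thesis by (simp add: card_field)
qed

text \<open>The projection of an arbitrary generator \<open>C\<close> to \<open>K\<close>: the sum of
  \<open>K\<close> and \<open>C \<inter> K\<^sup>\<bottom>\<close> is totally singular and has dimension
  \<open>n\<close>.\<close>

lemma singular_subspace_in_generator:
  assumes K: "totally_singular Q K"
  obtains N where "generator n Q N" "K \<subseteq> N"
proof -
  obtain C where C: "generator n Q C" using hyperbolic by (auto simp: hyperbolic_form_def)
  note sC = generatorD[OF C]
  have sK: "vec.subspace K" using K by (simp add: totally_singular_def)
  define D where "D = C \<inter> perp K"
  have sD: "vec.subspace D" using sC by (simp add: D_def vec.subspace_inter subspace_perp)
  define N where "N = {x + y |x y. x \<in> D \<and> y \<in> K}"
  have "D \<inter> K = C \<inter> K" using singular_subspace_perp[OF K] by (auto simp: D_def)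
  then have "vec.dim N = n"
    using vec.dim_sums_Int[OF sD sK] dim_generator_Int_perp[OF C sK] by (simp add: N_def D_def)
  moreover have "Q z = 0" if "z \<in> N" for z
    using that K sC(4) by (auto simp: N_def D_def Q_add totally_singular_def perp_def B_commute)
  ultimately have "generator n Q N"
    using vec.subspace_sums[OF sD sK] by (auto simp: generator_def totally_singular_def N_def)
  moreover have "K \<subseteq> N" using vec.subspace_0[OF sD] by (force simp: N_def)
  ultimately show thesis by (rule that)
qed

text \<open>Take a generator \<open>N\<close> containing \<open>K\<close> and count the pairs \<open>(v,
  x)\<close> in \<open>K\<^sup>\<bottom> \<times> N\<close> with \<open>v + x\<close> singular. For
  fixed \<open>x\<close> there are as many as singular vectors in \<open>K\<^sup>\<bottom>\<close>. For
  fixed \<open>v\<close> in \<open>N\<close> all \<open>x\<close> qualify; for \<open>v\<close> outside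
  \<open>N = N\<^sup>\<bottom>\<close>, the condition \<open>B v x = - Q v\<close> singles out an affine
  hyperplane of \<open>N\<close>.\<close>

lemma card_singular_perp_Diff:
  assumes K: "totally_singular Q K" and k: "Suc (vec.dim K + k) = n"
  shows "int (card {x \<in> perp K - K. Q x = 0}) = (int q ^ n - int q ^ vec.dim K) * (1 + int q ^ k)"
proof -
  obtain N where N: "generator n Q N" "K \<subseteq> N" using singular_subspace_in_generator K by blast
  note sN = generatorD[OF N(1)]
  have sK: "vec.subspace K" using K by (simp add: totally_singular_def)
  have NK: "N \<subseteq> perp K" using perp_generator[OF N(1)] N(2) unfolding perp_def by blast
  define S where "S = {x \<in> perp K. Q x = 0}"
  have translate: "card {v \<in> perp K. Q (v + x) = 0} = card S" if "x \<in> N" for x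
  proof (rule bij_betw_same_card)
    have x: "x \<in> perp K" using that NK by blast
    show "bij_betw (\<lambda>v. v + x) {v \<in> perp K. Q (v + x) = 0} S"
      by (rule bij_betw_byWitness[where f' = "\<lambda>y. y - x"])
        (use x subspace_perp[of K] in \<open>auto simp: S_def vec.subspace_add vec.subspace_diff\<close>)
  qed
  have off: "card {x \<in> N. Q (v + x) = 0} = q ^ (n - 1)" if "v \<notin> N" for v
  proof -
    have "{x \<in> N. Q (v + x) = 0} = {x \<in> N. B v x = - Q v}"
      using sN(4) by (auto simp: Q_add add_eq_0_iff)
    moreover have "v \<notin> perp N" using that perp_generator[OF N(1)] by simp
    ultimately have "q * card {x \<in> N. Q (v + x) = 0} = q * q ^ (n - 1)"
      using card_affine_hyperplane[OF sN(1)] card_generator[OF N(1)] rank_ge_2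
      by (simp flip: power_Suc)
    then show ?thesis using q_ge_2 by simp
  qed
  have on: "card {x \<in> N. Q (v + x) = 0} = q ^ n" if "v \<in> N" for v
  proof -
    have "{x \<in> N. Q (v + x) = 0} = N" using that sN(1,4) by (auto simp: vec.subspace_add)
    then show ?thesis using card_generator[OF N(1)] by simp
  qed
  have "vec.dim (perp K) = n + Suc k" using dim_perp[OF sK] k by linarith
  then have cK: "card (perp K) = q ^ n * q ^ Suc k"
    using card_subspace_q[OF subspace_perp, of K] by (simp only: power_add)
  have "q ^ n * card S = (\<Sum>x\<in>N. card {v \<in> perp K. Q (v + x) = 0})"
    using card_generator[OF N(1)] translate by simp
  also have "\<dots> = (\<Sum>v\<in>perp K. card {x \<in> N. Q (v + x) = 0})" by (rule double_counting) auto
  also have "\<dots> = (\<Sum>v\<in>perp K - N. card {x \<in> N. Q (v + x) = 0}) + (\<Sum>v\<in>N. card {x \<in> N. Q (v + x) = 0})"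
    using NK by (intro sum.subset_diff) auto
  also have "\<dots> = card (perp K - N) * q ^ (n - 1) + q ^ n * q ^ n"
    using on off card_generator[OF N(1)] by simp
  also have "card (perp K - N) = q ^ n * q ^ Suc k - q ^ n"
    using NK cK card_generator[OF N(1)] by (simp add: card_Diff_subset)
  also have "\<dots> = q ^ n * (q ^ Suc k - 1)" by (simp add: diff_mult_distrib2)
  finally have "q ^ n * card S = q ^ n * ((q ^ Suc k - 1) * q ^ (n - 1) + q ^ n)"
    by (simp add: algebra_simps)
  then have cS: "card S = (q ^ Suc k - 1) * q ^ (n - 1) + q ^ n" using q_ge_2 by simp
  have "{x \<in> perp K - K. Q x = 0} = S - K" by (auto simp: S_def)
  moreover have "K \<subseteq> S" using K singular_subspace_perp[OF K] by (auto simp: S_def totally_singular_def)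
  ultimately have "int (card {x \<in> perp K - K. Q x = 0}) = int (card S) - int (q ^ vec.dim K)"
    using card_subspace_q[OF sK] card_mono[of S K] by (simp add: card_Diff_subset of_nat_diff)
  also have "int (card S) = (int q * int q ^ k - 1) * int q ^ (n - 1) + int q ^ n"
    using q_ge_2 by (simp add: cS of_nat_diff)
  finally have "int (card {x \<in> perp K - K. Q x = 0}) =
    (int q * int q ^ k - 1) * int q ^ (n - 1) + int q ^ n - int q ^ vec.dim K" by simp
  moreover have "int q ^ n = int q * int q ^ vec.dim K * int q ^ k" "int q ^ (n - 1) = int q ^ vec.dim K * int q ^ k"
    unfolding k[symmetric] by (simp_all add: power_add)
  ultimately show ?thesis by (simp add: algebra_simps)
qed

text \<open>A member of \<open>F\<close> lies in \<open>K\<^sup>\<bottom>\<close> and consists of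
  singular vectors, so each is met \<open>q ^ n - q ^ dim K\<close> times. With the previous count this
  compares generators through \<open>K\<close> with generators through the spaces that exceed
  \<open>K\<close> by one dimension.\<close>

lemma generators_double_counting:
  assumes K: "vec.subspace K" and F: "\<And>W. W \<in> F \<Longrightarrow> generator n Q W \<and> K \<subseteq> W"
  shows "(\<Sum>x\<in>{x \<in> perp K - K. Q x = 0}. int (card {W \<in> F. x \<in> W}))
    = int (card F) * (int q ^ n - int q ^ vec.dim K)"
proof -
  have "(\<Sum>x\<in>{x \<in> perp K - K. Q x = 0}. card {W \<in> F. x \<in> W})
      = (\<Sum>W\<in>F. card {x \<in> {x \<in> perp K - K. Q x = 0}. x \<in> W})"
    by (rule double_counting) auto
  then have "(\<Sum>x\<in>{x \<in> perp K - K. Q x = 0}. int (card {W \<in> F. x \<in> W}))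
      = (\<Sum>W\<in>F. int (card {x \<in> {x \<in> perp K - K. Q x = 0}. x \<in> W}))"
    by (simp flip: of_nat_sum)
  also have "\<dots> = (\<Sum>W\<in>F. int q ^ n - int q ^ vec.dim K)"
  proof (rule sum.cong)
    fix W assume "W \<in> F"
    then have W: "generator n Q W" "K \<subseteq> W" using F by auto
    then have "W \<subseteq> perp K" using perp_generator[OF W(1)] unfolding perp_def by blast
    then have "{x \<in> {x \<in> perp K - K. Q x = 0}. x \<in> W} = W - K"
      using generatorD(4)[OF W(1)] by auto
    then show "int (card {x \<in> {x \<in> perp K - K. Q x = 0}. x \<in> W}) = int q ^ n - int q ^ vec.dim K"
      using card_generator[OF W(1)] card_subspace_q[OF K] card_mono[OF _ W(2)] W(2)
      by (simp add: card_Diff_subset of_nat_diff)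
  qed simp
  finally show ?thesis by simp
qed

lemma q_power_gt: "i < j \<Longrightarrow> int q ^ i < int q ^ j"
  using q_ge_2 by (intro power_strict_increasing) auto

text \<open>Each singular vector of \<open>K\<^sup>\<bottom>\<close> outside \<open>K\<close> lies in
  exactly one generator through \<open>K\<close>, and there are twice as many such vectors as one
  generator accounts for.\<close>

lemma two_generators_on_hyperplane:
  assumes K: "totally_singular Q K" and dK: "Suc (vec.dim K) = n"
  shows "card {W. generator n Q W \<and> K \<subseteq> W} = 2"
proof -
  have sK: "vec.subspace K" using K by (simp add: totally_singular_def)
  let ?F = "{W. generator n Q W \<and> K \<subseteq> W}"
  have one: "card {W \<in> ?F. x \<in> W} = 1" if "x \<in> {x \<in> perp K - K. Q x = 0}" for x
  proof -
    let ?W = "vec.span (insert x K)"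
    have d: "vec.dim ?W = n" using dim_span_insert[OF sK, of x] that dK by simp
    have "generator n Q ?W"
      using totally_singular_insert[OF K, of x] that d by (simp add: generator_def)
    moreover have "x \<in> ?W" "K \<subseteq> ?W" by (auto simp: vec.span_base)
    moreover have "W = ?W" if W: "generator n Q W" "K \<subseteq> W" "x \<in> W" for W
      using W generatorD[OF W(1)] d
      by (intro vec.subspace_dim_equal[symmetric] vec.span_minimal) auto
    ultimately have "{W \<in> ?F. x \<in> W} = {?W}" by blast
    then show ?thesis by simp
  qed
  have "(\<Sum>x\<in>{x \<in> perp K - K. Q x = 0}. int (card {W \<in> ?F. x \<in> W}))
      = int (card {x \<in> perp K - K. Q x = 0})"
    using one by simp
  then have eq: "int (card ?F) * (int q ^ n - int q ^ vec.dim K) = 2 * (int q ^ n - int q ^ vec.dim K)"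
    using generators_double_counting[OF sK, of ?F] card_singular_perp_Diff[OF K, of 0] dK by simp
  have "int q ^ n - int q ^ vec.dim K \<noteq> 0" using q_power_gt[of "vec.dim K" n] dK by simp
  then have "int (card ?F) = 2" using eq mult_right_cancel by blast
  then show ?thesis by simp
qed

text \<open>Induction on the codimension of \<open>K\<close> in a generator. In the base case the two
  generators on \<open>K\<close> meet in a hyperplane, so they are of different classes. In the step,
  each of the \<open>(q ^ n - q ^ dim K) (1 + q ^ (k + 1))\<close> singular vectors extending
  \<open>K\<close> is in the number of generators given by the induction hypothesis, and each generator
  is counted \<open>q ^ n - q ^ dim K\<close> times.\<close>

lemma card_generators_of_class_through:
  assumes E: "generator n Q E" and K: "totally_singular Q K" and k: "Suc (vec.dim K + k) = n"
  shows "card {W. generator n Q W \<and> K \<subseteq> W \<and> same_class n W E = b} = (\<Prod>j=1..k. 1 + q ^ j)"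
  using K k
proof (induction k arbitrary: K)
  case 0
  have sK: "vec.subspace K" using 0 by (simp add: totally_singular_def)
  obtain A C where AC: "{W. generator n Q W \<and> K \<subseteq> W} = {A, C}" "A \<noteq> C"
    using two_generators_on_hyperplane[of K] 0 by (auto simp: card_2_iff)
  then have A: "generator n Q A" "K \<subseteq> A" and C: "generator n Q C" "K \<subseteq> C" by auto
  have "vec.dim (A \<inter> C) \<noteq> n" using generator_eqI A C AC by blast
  moreover have "vec.dim (A \<inter> C) \<le> n"
    using vec.dim_subset[of "A \<inter> C" A] generatorD[OF A(1)] by simp
  moreover have "vec.dim K \<le> vec.dim (A \<inter> C)" using A C by (intro vec.dim_subset) auto
  ultimately have "n = Suc (vec.dim (A \<inter> C))" using 0 by linarith
  then have "\<not> same_class n A C" unfolding same_class_iff_even by presburger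
  then have "same_class n A E \<longleftrightarrow> \<not> same_class n C E"
    using same_class_triangle[OF A(1) C(1) E] same_class_triangle[OF A(1) E C(1)] same_class_sym
    by blast
  moreover have "{W. generator n Q W \<and> K \<subseteq> W \<and> same_class n W E = b}
      = {W \<in> {A, C}. same_class n W E = b}"
    unfolding AC(1)[symmetric] by auto
  ultimately have "\<exists>W. {W. generator n Q W \<and> K \<subseteq> W \<and> same_class n W E = b} = {W}"
    using AC(2) by (cases b; cases "same_class n A E") auto
  then show ?case by auto
next
  case (Suc k)
  have sK: "vec.subspace K" using Suc by (simp add: totally_singular_def)
  let ?F = "{W. generator n Q W \<and> K \<subseteq> W \<and> same_class n W E = b}"
  have step: "card {W \<in> ?F. x \<in> W} = (\<Prod>j=1..k. 1 + q ^ j)" if x: "x \<in> {x \<in> perp K - K. Q x = 0}" for x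
  proof -
    let ?W = "vec.span (insert x K)"
    have "?W \<subseteq> W \<longleftrightarrow> x \<in> W \<and> K \<subseteq> W" if "generator n Q W" for W
      using generatorD(1)[OF that] vec.span_superset[of "insert x K"] vec.span_minimal[of "insert x K" W]
      by auto
    then have "{W \<in> ?F. x \<in> W} = {W. generator n Q W \<and> ?W \<subseteq> W \<and> same_class n W E = b}" by auto
    moreover have "totally_singular Q ?W" using totally_singular_insert[of K x] Suc x by auto
    moreover have "Suc (vec.dim ?W + k) = n" using dim_span_insert[OF sK, of x] x Suc by simp
    ultimately show ?thesis using Suc.IH[of ?W] by simp
  qed
  have "int (card ?F) * (int q ^ n - int q ^ vec.dim K)
      = int (card {x \<in> perp K - K. Q x = 0}) * int (\<Prod>j=1..k. 1 + q ^ j)"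
    using generators_double_counting[OF sK, of ?F] step by simp
  also have "\<dots> = (int q ^ n - int q ^ vec.dim K) * int (\<Prod>j=1..Suc k. 1 + q ^ j)"
    using card_singular_perp_Diff[of K "Suc k"] Suc.prems by (simp add: distrib_left distrib_right mult_ac)
  finally have "int (card ?F) = int (\<Prod>j=1..Suc k. 1 + q ^ j)"
    using q_power_gt[of "vec.dim K" n] Suc.prems by (simp del: of_nat_prod prod.cl_ivl_Suc)
  then show ?case by (simp only: of_nat_eq_iff)
qed

lemma zero_subspace: "totally_singular Q {0}" "vec.dim {0 :: 'a ^ 'm} = 0"
  by (auto simp: totally_singular_def)

lemma point_span: "Q x = 0 \<Longrightarrow> x \<noteq> 0 \<Longrightarrow> point Q (vec.span {x})"
  using totally_singular_insert[OF zero_subspace(1), of x]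
  by (simp add: perp_def vec.span_insert_0 insert_commute[of x] point_def)

text \<open>The products that count all generators of a class and those on \<open>P\<close> differ in
  the factor \<open>1 + q ^ (n - 1)\<close>.\<close>

lemma card_generators_of_class_ratio:
  assumes E: "generator n Q E" and P: "point Q P"
  shows "card {W. generator n Q W \<and> same_class n W E = b} =
    card {W. generator n Q W \<and> same_class n W E = b \<and> P \<subseteq> W} * (1 + q ^ (n - 1))"
proof -
  obtain k where k: "n = Suc (Suc k)" using rank_ge_2 by (metis add_2_eq_Suc le_Suc_ex)
  have "card {W. generator n Q W \<and> {0} \<subseteq> W \<and> same_class n W E = b} = (\<Prod>j=1..Suc k. 1 + q ^ j)"
    using k zero_subspace by (intro card_generators_of_class_through E) auto
  moreover have "{W. generator n Q W \<and> {0} \<subseteq> W \<and> same_class n W E = b}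
      = {W. generator n Q W \<and> same_class n W E = b}"
    using generatorD(1) vec.subspace_0 by blast
  moreover have "card {W. generator n Q W \<and> P \<subseteq> W \<and> same_class n W E = b} = (\<Prod>j=1..k. 1 + q ^ j)"
    using k P by (intro card_generators_of_class_through E) (auto simp: point_def)
  moreover have "{W. generator n Q W \<and> P \<subseteq> W \<and> same_class n W E = b}
      = {W. generator n Q W \<and> same_class n W E = b \<and> P \<subseteq> W}" by auto
  ultimately show ?thesis using k by simp
qed

text \<open>The generators \<open>U\<close> of the other class meet \<open>W\<close> in dimension 1 or
  3. Their number, and the number of pairs of such a \<open>U\<close> with a nonzero vector of \<open>U
  \<inter> W\<close>, give two linear equations for the numbers of the two kinds; the solution has
  \<open>(1 + q) (1 + q\<^sup>2)\<close> of dimension 3, out of \<open>(1 + q) (1 + q\<^sup>2) (1 +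
  q\<^sup>3)\<close>.\<close>

lemma card_adjacent_generators_ratio:
  assumes n: "n = 4" and W: "generator n Q W"
  shows "card {U. generator n Q U \<and> \<not> same_class n U W} =
    card {U. generator n Q U \<and> \<not> same_class n U W \<and> vec.dim (U \<inter> W) = n - 1} * (1 + q ^ (n - 1))"
proof -
  note sW = generatorD[OF W]
  define F where "F = {U. generator n Q U \<and> \<not> same_class n U W}"
  define H where "H = {U \<in> F. vec.dim (U \<inter> W) = 3}"
  have "card {U. generator n Q U \<and> {0} \<subseteq> U \<and> same_class n U W = False} = (\<Prod>j=1..3. 1 + q ^ j)"
    using zero_subspace n by (intro card_generators_of_class_through W) auto
  moreover have "{U. generator n Q U \<and> {0} \<subseteq> U \<and> same_class n U W = False} = F"
    unfolding F_def using generatorD(1) vec.subspace_0 by blast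
  ultimately have cF: "card F = (1 + q) * (1 + q\<^sup>2) * (1 + q ^ 3)"
    by (simp add: numeral_3_eq_3 numeral_2_eq_2)
  have thru: "card {U \<in> F. x \<in> U} = (1 + q) * (1 + q\<^sup>2)" if x: "x \<in> W - {0}" for x
  proof -
    have "point Q (vec.span {x})" using point_span sW(4) x by blast
    then have "card {U. generator n Q U \<and> vec.span {x} \<subseteq> U \<and> same_class n U W = False} = (\<Prod>j=1..2. 1 + q ^ j)"
      using n by (intro card_generators_of_class_through W) (auto simp: point_def)
    moreover have "vec.span {x} \<subseteq> U \<longleftrightarrow> x \<in> U" if "generator n Q U" for U
      using generatorD(1)[OF that] vec.span_superset[of "{x}"] vec.span_minimal[of "{x}" U] by auto
    then have "{U. generator n Q U \<and> vec.span {x} \<subseteq> U \<and> same_class n U W = False} = {U \<in> F. x \<in> U}"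
      unfolding F_def by auto
    ultimately show ?thesis by (simp add: numeral_2_eq_2)
  qed
  have meet: "int (card {x \<in> W - {0}. x \<in> U}) = int q ^ vec.dim (U \<inter> W) - 1" if "U \<in> F" for U
  proof -
    have U: "vec.subspace (U \<inter> W)"
      using that sW generatorD(1)[of U] by (auto simp: F_def vec.subspace_inter)
    have "{x \<in> W - {0}. x \<in> U} = (U \<inter> W) - {0}" by auto
    then show ?thesis using card_subspace_q[OF U] vec.subspace_0[OF U] q_ge_2
      by (simp add: card_Diff_subset of_nat_diff)
  qed
  have dims: "vec.dim (U \<inter> W) = 1" if "U \<in> F - H" for U
  proof -
    have "odd (vec.dim (U \<inter> W) + n)" using that unfolding F_def same_class_iff_even by blast
    then have "vec.dim (U \<inter> W) \<le> 4" "odd (vec.dim (U \<inter> W))" "vec.dim (U \<inter> W) \<noteq> 3"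
      using that vec.dim_subset[of "U \<inter> W" W] sW(3) n by (auto simp: H_def)
    moreover have "d = 1" if "d \<le> 4" "odd d" "d \<noteq> 3" for d :: nat using that by presburger
    ultimately show ?thesis by blast
  qed
  have "Suc (card (W - {0})) = q ^ 4"
    using card_Suc_Diff1[OF _ vec.subspace_0[OF sW(1)]] card_generator[OF W] n by simp
  then have "int (q ^ 4) = int (card (W - {0})) + 1" by (metis of_nat_Suc add.commute)
  then have cW: "int (card (W - {0})) = int q ^ 4 - 1" by simp
  have "int ((1 + q) * (1 + q\<^sup>2)) * (int q ^ 4 - 1) = int (\<Sum>x\<in>W - {0}. card {U \<in> F. x \<in> U})"
    by (simp only: sum.cong[OF refl thru] sum_constant of_nat_mult of_nat_id cW mult.commute)
  also have "(\<Sum>x\<in>W - {0}. card {U \<in> F. x \<in> U}) = (\<Sum>U\<in>F. card {x \<in> W - {0}. x \<in> U})"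
    by (rule double_counting) auto
  also have "int \<dots> = (\<Sum>U\<in>F. int q ^ vec.dim (U \<inter> W) - 1)" using meet by simp
  also have "\<dots> = (\<Sum>U\<in>F - H. int q ^ vec.dim (U \<inter> W) - 1) + (\<Sum>U\<in>H. int q ^ vec.dim (U \<inter> W) - 1)"
    by (rule sum.subset_diff) (auto simp: H_def)
  also have "\<dots> = int (card (F - H)) * (int q - 1) + int (card H) * (int q ^ 3 - 1)"
  proof -
    have "(\<Sum>U\<in>F - H. int q ^ vec.dim (U \<inter> W) - 1) = (\<Sum>U\<in>F - H. int q - 1)"
      by (rule sum.cong) (simp_all only: dims power_one_right)
    moreover have "(\<Sum>U\<in>H. int q ^ vec.dim (U \<inter> W) - 1) = (\<Sum>U\<in>H. int q ^ 3 - 1)"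
      by (rule sum.cong) (simp_all add: H_def)
    ultimately show ?thesis by simp
  qed
  also have "int (card (F - H)) = int (card F) - int (card H)"
    using card_mono[of F H] by (simp add: H_def card_Diff_subset of_nat_diff)
  finally have "int (card H) * (int q ^ 3 - int q) = (1 + int q) * (1 + int q ^ 2) * (int q ^ 3 - int q)"
    by (simp add: cF algebra_simps power_numeral_reduce)
  moreover have "int q ^ 3 - int q \<noteq> 0" using q_power_gt[of 1 3] by simp
  ultimately have "int (card H) = (1 + int q) * (1 + int q ^ 2)" by simp
  also have "\<dots> = int ((1 + q) * (1 + q\<^sup>2))" by (simp add: distrib_left distrib_right)
  finally have "card H = (1 + q) * (1 + q\<^sup>2)" by (simp only: of_nat_eq_iff)
  moreover have "{U. generator n Q U \<and> \<not> same_class n U W \<and> vec.dim (U \<inter> W) = n - 1} = H"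
    using n by (auto simp: F_def H_def)
  ultimately show ?thesis using cF n by (simp add: F_def)
qed

lemma card_nonzero_vectors_of_points:
  assumes F: "\<And>P. P \<in> F \<Longrightarrow> point Q P"
  shows "card (\<Union>F - {0}) = card F * (q - 1)"
proof -
  have eq: "P = vec.span {x}" if "P \<in> F" "x \<in> P" "x \<noteq> 0" for P x
    using that F[OF that(1)]
    by (intro vec.subspace_dim_equal[symmetric] vec.span_minimal) (auto simp: point_def totally_singular_def)
  have "\<Union>F - {0} = (\<Union>P\<in>F. P - {0})" by auto
  also have "card \<dots> = (\<Sum>P\<in>F. card (P - {0}))"
  proof (rule card_UN_disjoint)
    show "\<forall>P\<in>F. \<forall>R\<in>F. P \<noteq> R \<longrightarrow> (P - {0}) \<inter> (R - {0}) = {}" using eq by blast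
  qed simp_all
  also have "\<dots> = (\<Sum>P\<in>F. q - 1)"
  proof (rule sum.cong)
    fix P assume "P \<in> F"
    then have P: "vec.subspace P" "vec.dim P = 1" using F by (auto simp: point_def totally_singular_def)
    then show "card (P - {0}) = q - 1"
      using card_subspace_q[OF P(1)] vec.subspace_0[OF P(1)] by (simp add: card_Diff_subset)
  qed simp
  finally show ?thesis by simp
qed

text \<open>Multiplied by \<open>q - 1\<close>, both cardinalities count nonzero singular vectors: all
  of them, and those in \<open>N\<close>.\<close>

lemma card_points_ratio:
  assumes N: "generator n Q N"
  shows "card {P. point Q P} = card {P. point Q P \<and> P \<subseteq> N} * (1 + q ^ (n - 1))"
proof -
  have "\<Union>{P. point Q P} - {0} = {x \<in> perp {0} - {0}. Q x = 0}"
  proof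
    show "\<Union>{P. point Q P} - {0} \<subseteq> {x \<in> perp {0} - {0}. Q x = 0}"
      by (auto simp: point_def totally_singular_def perp_def)
    show "{x \<in> perp {0} - {0}. Q x = 0} \<subseteq> \<Union>{P. point Q P} - {0}"
      using point_span vec.span_base by blast
  qed
  then have "int (card {P. point Q P} * (q - 1)) = (int q ^ n - 1) * (1 + int q ^ (n - 1))"
    using card_nonzero_vectors_of_points[of "{P. point Q P}"] card_singular_perp_Diff[OF zero_subspace(1), of "n - 1"]
      zero_subspace rank_ge_2 by simp
  moreover have "\<Union>{P. point Q P \<and> P \<subseteq> N} - {0} = N - {0}"
  proof
    show "N - {0} \<subseteq> \<Union>{P. point Q P \<and> P \<subseteq> N} - {0}"
    proof
      fix x assume x: "x \<in> N - {0}"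
      then have "point Q (vec.span {x})" "vec.span {x} \<subseteq> N" "x \<in> vec.span {x}"
        using generatorD[OF N] point_span by (auto intro: vec.span_base vec.span_minimal[THEN subsetD])
      then show "x \<in> \<Union>{P. point Q P \<and> P \<subseteq> N} - {0}" using x by blast
    qed
  qed auto
  then have "card {P. point Q P \<and> P \<subseteq> N} * (q - 1) = q ^ n - 1"
    using card_nonzero_vectors_of_points[of "{P. point Q P \<and> P \<subseteq> N}"] card_generator[OF N]
      vec.subspace_0[OF generatorD(1)[OF N]]
    by (simp add: card_Diff_subset)
  then have "int (card {P. point Q P \<and> P \<subseteq> N} * (q - 1)) = int q ^ n - 1"
    using q_ge_2 by (simp only: of_nat_diff of_nat_power of_nat_1 one_le_power)
  ultimately have "int (card {P. point Q P} * (q - 1))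
      = int (card {P. point Q P \<and> P \<subseteq> N} * (q - 1) * (1 + q ^ (n - 1)))"
    by (simp add: distrib_left)
  then have "card {P. point Q P} * (q - 1) = card {P. point Q P \<and> P \<subseteq> N} * (1 + q ^ (n - 1)) * (q - 1)"
    by (simp only: of_nat_eq_iff mult_ac)
  then show ?thesis using q_ge_2 by simp
qed

end

section \<open>Frames and opposition\<close>

definition standard_index_sets :: "nat \<Rightarrow> int set set" where
  "standard_index_sets n =
     {{1..int i} | i. i \<in> {1..n - 2}} \<union> {{1..int n}, {1..int n - 1} \<union> {- int n}}"

lemma standard_flag_index_sets: "standard_flag n e = frame_span e ` standard_index_sets n"
  by (auto simp: standard_flag_def standard_index_sets_def)

lemma standard_index_setsE:
  assumes "I \<in> standard_index_sets n" "2 \<le> n"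
  obtains (small) i where "1 \<le> i" "i \<le> n - 2" "I = {1..int i}" "card I = i"
    | (generator) "I = {1..int n} \<or> I = {1..int n - 1} \<union> {- int n}" "card I = n"
proof -
  have "card ({1..int n - 1} \<union> {- int n}) = n"
    using assms(2) by (subst card_Un_disjoint) auto
  then show thesis
    using assms small generator by (auto simp: standard_index_sets_def)
qed

lemma standard_index_sets_subset: "I \<in> standard_index_sets n \<Longrightarrow> 2 \<le> n \<Longrightarrow> I \<subseteq> frame_index n"
  by (auto simp: standard_index_sets_def frame_index_def)

lemma inj_w0: "inj (w0 n)"
  by (auto simp: inj_def w0_def split: if_splits)

lemma w0_frame_index: "i \<in> frame_index n \<Longrightarrow> w0 n i \<in> frame_index n"
  by (auto simp: frame_index_def w0_def)

lemma linear_inv: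
  assumes "Vector_Spaces.linear (*s) (*s) (f :: 'a::field ^ 'm \<Rightarrow> 'a ^ 'm)" "bij f"
  shows "Vector_Spaces.linear (*s) (*s) (inv f)"
proof -
  have a: "f (inv f x) = x" "inv f (f x) = x" for x
    using assms(2) by (simp_all add: bij_is_surj surj_f_inv_f bij_is_inj)
  have "f (inv f x + inv f y) = x + y" "f (c *s inv f x) = c *s x" for x y c
    using assms(1) a(1) by (simp_all add: Vector_Spaces.linear_iff)
  then have "inv f (x + y) = inv f x + inv f y" "inv f (c *s x) = c *s inv f x" for x y c
    using a(2) by metis+
  then show ?thesis by (simp add: Vector_Spaces.linear_iff vec.vector_space_axioms)
qed

lemma surj_projectivity:
  assumes "Vector_Spaces.linear (*s) (*s) (f :: 'a::field ^ 'm \<Rightarrow> 'a ^ 'm)" "bij f"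
  shows "surj (projectivity f)"
proof (rule surjI)
  fix U
  have "f ` (inv f ` U) = U" using assms(2) by (simp add: bij_is_surj image_f_inv_f)
  then show "projectivity f (projectivity (inv f) U) = U"
    using vec.linear_subspace_image[OF linear_inv[OF assms], of U] by (simp add: projectivity_def)
qed

lemma subspace_frame_span [simp]: "vec.subspace (frame_span e I)"
  by (simp add: frame_span_def)

lemma PGO_E:
  assumes "g \<in> PGO n Q"
  obtains f c where "g = projectivity f" "Vector_Spaces.linear (*s) (*s) f" "bij f"
    "c \<noteq> 0" "\<And>x. Q (f x) = c * Q x"
  using assms unfolding PGO_def by blast

locale framed_space = hyperbolic_space Q n q
  for Q :: "'a::{field,finite} ^ 'm \<Rightarrow> 'a" and n q +
  fixes e :: "int \<Rightarrow> ('a ^ 'm) set"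
  assumes frame: "polar_frame n Q e"
begin

definition frame_vector :: "int \<Rightarrow> 'a ^ 'm" where
  "frame_vector i = (SOME x. x \<in> e i \<and> x \<noteq> 0)"

lemma subspace_e: "i \<in> frame_index n \<Longrightarrow> vec.subspace (e i)"
  using frame by (auto simp: polar_frame_def point_def totally_singular_def)

lemma frame_vector:
  assumes i: "i \<in> frame_index n"
  shows "frame_vector i \<noteq> 0" "Q (frame_vector i) = 0" "e i = vec.span {frame_vector i}"
proof -
  have p: "totally_singular Q (e i)" "vec.dim (e i) = 1"
    using frame i by (auto simp: polar_frame_def point_def)
  then have "\<not> e i \<subseteq> {0}" by (metis vec.dim_eq_0 zero_neq_one)
  then have "\<exists>x. x \<in> e i \<and> x \<noteq> 0" by blast
  then have x: "frame_vector i \<in> e i \<and> frame_vector i \<noteq> 0" unfolding frame_vector_def by (rule someI_ex)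
  then show "frame_vector i \<noteq> 0" by simp
  show "Q (frame_vector i) = 0" using x p by (simp add: totally_singular_def)
  show "e i = vec.span {frame_vector i}"
    using x p by (intro vec.subspace_dim_equal[symmetric] vec.span_minimal) (auto simp: totally_singular_def)
qed

lemma B_frame_vector:
  assumes i: "i \<in> frame_index n" and j: "j \<in> frame_index n"
  shows "B (frame_vector i) (frame_vector j) = 0 \<longleftrightarrow> j \<noteq> - i"
proof -
  let ?x = "frame_vector i" and ?y = "frame_vector j"
  have "collinear_points Q (e i) (e j) \<longleftrightarrow> B ?x ?y = 0"
  proof
    assume "collinear_points Q (e i) (e j)"
    then have ts: "totally_singular Q (vec.span (e i \<union> e j))" by (simp add: collinear_points_def)
    have "?x \<in> vec.span (e i \<union> e j)" "?y \<in> vec.span (e i \<union> e j)"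
      using frame_vector(3)[OF i] frame_vector(3)[OF j] by (auto intro: vec.span_base)
    then show "B ?x ?y = 0" using singular_subspace_perp[OF ts] by (auto simp: perp_def)
  next
    assume b: "B ?x ?y = 0"
    have "totally_singular Q (vec.span {?x})"
      using point_span frame_vector[OF i] by (simp add: point_def)
    moreover have "?y \<in> perp (vec.span {?x})" unfolding perp_span using b by (simp add: perp_def)
    ultimately have ts: "totally_singular Q (vec.span (insert ?y (vec.span {?x})))"
      using totally_singular_insert frame_vector(2)[OF j] by blast
    have sub: "vec.span (e i \<union> e j) \<subseteq> vec.span (insert ?y (vec.span {?x}))"
      using frame_vector(3)[OF i] frame_vector(3)[OF j] vec.span_mono[of "{?y}" "insert ?y (vec.span {?x})"]
      by (intro vec.span_minimal) (auto intro: vec.span_base)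
    then show "collinear_points Q (e i) (e j)"
      using ts by (auto simp: collinear_points_def totally_singular_def)
  qed
  then show ?thesis using frame i j by (auto simp: polar_frame_def)
qed

lemma frame_span_vectors:
  assumes "I \<subseteq> frame_index n"
  shows "frame_span e I = vec.span (frame_vector ` I)"
proof
  have "e i \<subseteq> vec.span (frame_vector ` I)" if "i \<in> I" for i
    using frame_vector(3)[of i] that assms vec.span_mono[of "{frame_vector i}" "frame_vector ` I"] by auto
  then show "frame_span e I \<subseteq> vec.span (frame_vector ` I)"
    unfolding frame_span_def by (intro vec.span_minimal) auto
  have "frame_vector i \<in> e i" if "i \<in> I" for i
    using frame_vector(3)[of i] that assms by (auto intro: vec.span_base)
  then show "vec.span (frame_vector ` I) \<subseteq> frame_span e I"
    unfolding frame_span_def by (intro vec.span_mono) auto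
qed

text \<open>Pairing with \<open>e\<^sub>-\<^sub>j\<close> annihilates every frame vector except the one
  of index \<open>j\<close>, so the \<open>j\<close>-th is not in the span of the others.\<close>

lemma dim_frame_span:
  assumes "I \<subseteq> frame_index n"
  shows "vec.dim (frame_span e I) = card I"
proof -
  have "finite I" using assms by (rule finite_subset) (simp add: frame_index_def)
  then have "vec.dim (frame_vector ` I) = card I" using assms
  proof (induction I rule: finite_induct)
    case (insert j I)
    then have j: "j \<in> frame_index n" "- j \<in> frame_index n" by (auto simp: frame_index_def)
    have "frame_vector ` I \<subseteq> perp {frame_vector (- j)}"
      using insert j B_frame_vector[OF j(2)] by (auto simp: perp_def)
    then have "vec.span (frame_vector ` I) \<subseteq> perp {frame_vector (- j)}"
      by (intro vec.span_minimal subspace_perp)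
    moreover have "frame_vector j \<notin> perp {frame_vector (- j)}"
      using B_frame_vector[OF j(2,1)] by (simp add: perp_def)
    ultimately have "frame_vector j \<notin> vec.span (frame_vector ` I)" by blast
    then show ?case using insert by (simp add: vec.dim_insert)
  qed simp
  then show ?thesis using frame_span_vectors[OF assms] by simp
qed

lemma dim_frame_span_Int:
  assumes I: "I \<subseteq> frame_index n" and J: "J \<subseteq> frame_index n"
  shows "vec.dim (frame_span e I \<inter> frame_span e J) = card (I \<inter> J)"
proof -
  have "{x + y |x y. x \<in> frame_span e I \<and> y \<in> frame_span e J} = frame_span e (I \<union> J)"
    unfolding frame_span_def by (simp add: vec.span_Un)
  moreover have "finite I" "finite J"
    using I J by (auto intro: finite_subset simp: frame_index_def)
  ultimately show ?thesis
    using vec.dim_sums_Int[of "frame_span e I" "frame_span e J"] card_Un_Int[of I J]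
      dim_frame_span[OF I] dim_frame_span[OF J] dim_frame_span[of "I \<union> J"] I J by simp
qed

lemma totally_singular_frame_span:
  assumes "I \<subseteq> frame_index n" "\<And>i. i \<in> I \<Longrightarrow> - i \<notin> I"
  shows "totally_singular Q (frame_span e I)"
proof -
  have "finite I" using assms(1) by (rule finite_subset) (simp add: frame_index_def)
  then have "totally_singular Q (vec.span (frame_vector ` I))" using assms
  proof (induction I rule: finite_induct)
    case empty
    then show ?case by (simp add: zero_subspace)
  next
    case (insert j I)
    have "B (frame_vector i) (frame_vector j) = 0" if "i \<in> I" for i
    proof -
      have "j \<noteq> - i" using insert.prems(2)[of i] that by blast
      then show ?thesis using B_frame_vector[of i j] insert.prems(1) that by blast
    qed
    then have "frame_vector j \<in> perp (vec.span (frame_vector ` I))"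
      unfolding perp_span by (auto simp: perp_def)
    then have "totally_singular Q (vec.span (insert (frame_vector j) (vec.span (frame_vector ` I))))"
      using insert frame_vector(2)[of j] by (intro totally_singular_insert) auto
    moreover have "vec.span (frame_vector ` insert j I) \<subseteq> vec.span (insert (frame_vector j) (vec.span (frame_vector ` I)))"
      by (intro vec.span_mono) (auto intro: vec.span_base)
    ultimately show ?case by (auto simp: totally_singular_def)
  qed
  then show ?thesis using frame_span_vectors assms by simp
qed

text \<open>This generator tells the types \<open>n\<close> and \<open>n'\<close> apart.\<close>

abbreviation E where "E \<equiv> frame_span e {1..int n}"

lemma generator_E: "generator n Q E"
proof -
  have "{1..int n} \<subseteq> frame_index n" by (auto simp: frame_index_def)
  then show ?thesis
    using totally_singular_frame_span[of "{1..int n}"] dim_frame_span[of "{1..int n}"]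
    by (auto simp: generator_def)
qed

lemma id_Borel: "id \<in> Borel n Q e"
proof -
  have "projectivity id = (id :: ('a ^ 'm) set \<Rightarrow> _)" by (rule ext) (simp add: projectivity_def)
  moreover have "same_class n N (id ` N)" if "generator n Q N" for N
    using generatorD(3)[OF that] by (simp add: same_class_def)
  moreover have "\<exists>c. c \<noteq> 0 \<and> (\<forall>x. Q (id x) = c * Q x)" by (rule exI[of _ 1]) simp
  ultimately have "(id :: ('a ^ 'm) set \<Rightarrow> _) \<in> PGO n Q"
    unfolding PGO_def mem_Collect_eq
    by (intro exI[of _ "id :: 'a ^ 'm \<Rightarrow> _"] conjI allI impI) (simp_all only: vec.linear_id bij_id)
  then show ?thesis by (simp add: Borel_def)
qed

text \<open>Let \<open>g\<close>, \<open>h\<close> and \<open>w\<close> be the group elements of the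
  definition. As the identity belongs to the Borel subgroup, \<open>h\<^sup>-\<^sup>1 g = b w b'\<close>
  with \<open>b\<close> and \<open>b'\<close> fixing the standard flag \<open>F\<close>. Thus \<open>g F
  = (h b) w F\<close> and \<open>h F = (h b) F\<close>, and \<open>k\<close> induces \<open>h
  b\<close>.\<close>

lemma opposite_maximal_normal_form:
  assumes "opposite_maximal n Q e M1 M2"
  obtains k c where "Vector_Spaces.linear (*s) (*s) k" "inj k" "c \<noteq> 0" "\<And>x. Q (k x) = c * Q x"
    "M1 = (\<lambda>I. k ` frame_span e (w0 n ` I)) ` standard_index_sets n"
    "M2 = (\<lambda>I. k ` frame_span e I) ` standard_index_sets n"
proof -
  let ?F = "standard_flag n e"
  obtain g h w where ghw: "g \<in> PGO n Q" "h \<in> PGO n Q" "w \<in> PGO n Q"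
    and M: "M1 = g ` ?F" "M2 = h ` ?F"
    and w: "\<And>i. i \<in> frame_index n \<Longrightarrow> w (e i) = e (w0 n i)"
    and dc: "double_coset (Borel n Q e) (inv h \<circ> g) = double_coset (Borel n Q e) w"
    using assms unfolding opposite_maximal_def by blast
  have "id \<circ> (inv h \<circ> g) \<circ> id \<in> double_coset (Borel n Q e) (inv h \<circ> g)"
    unfolding double_coset_def using id_Borel by blast
  then have "inv h \<circ> g \<in> double_coset (Borel n Q e) w" by (simp add: dc)
  then obtain b b' where b: "b \<in> Borel n Q e" "b' \<in> Borel n Q e" and hg: "inv h \<circ> g = b \<circ> w \<circ> b'"
    unfolding double_coset_def by blast
  have bF: "b ` ?F = ?F" "b' ` ?F = ?F" and bP: "b \<in> PGO n Q" using b by (auto simp: Borel_def)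
  obtain fh ch where fh: "h = projectivity fh" "Vector_Spaces.linear (*s) (*s) fh" "bij fh"
    "ch \<noteq> 0" "\<And>x. Q (fh x) = ch * Q x" using ghw(2) by (rule PGO_E) blast
  obtain fb cb where fb: "b = projectivity fb" "Vector_Spaces.linear (*s) (*s) fb" "bij fb"
    "cb \<noteq> 0" "\<And>x. Q (fb x) = cb * Q x" using bP by (rule PGO_E) blast
  obtain fw cw where fw: "w = projectivity fw" "Vector_Spaces.linear (*s) (*s) fw" "bij fw"
    "cw \<noteq> 0" "\<And>x. Q (fw x) = cw * Q x" using ghw(3) by (rule PGO_E) blast
  have "h (inv h U) = U" for U using surj_projectivity[OF fh(2,3)] by (simp add: fh(1) surj_f_inv_f)
  then have "g U = h (b (w (b' U)))" for U using fun_cong[OF hg, of U] by (metis comp_apply)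
  then have "M1 = h ` b ` w ` b' ` ?F" by (simp add: M(1) image_comp comp_def)
  then have M1: "M1 = h ` b ` w ` ?F" by (simp only: bF)
  have M2: "M2 = h ` b ` ?F" by (simp only: M bF)
  define k where "k = fh \<circ> fb"
  have k: "h (b U) = k ` U" if "vec.subspace U" for U
    using that vec.linear_subspace_image[OF fb(2) that] by (simp add: fh fb projectivity_def k_def image_comp)
  have ws: "w (frame_span e I) = frame_span e (w0 n ` I)" if "I \<subseteq> frame_index n" for I
  proof -
    have "fw ` e i = e (w0 n i)" if "i \<in> I" for i
      using w[of i] subspace_e[of i] \<open>I \<subseteq> frame_index n\<close> that by (auto simp: fw(1) projectivity_def)
    then have "fw ` (\<Union>i\<in>I. e i) = (\<Union>i\<in>w0 n ` I. e i)" by (auto simp: image_UN)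
    then have "fw ` frame_span e I = frame_span e (w0 n ` I)"
      using vec.linear_span_image[OF fw(2), of "\<Union>i\<in>I. e i"] by (simp add: frame_span_def)
    then show ?thesis by (simp add: fw(1) projectivity_def)
  qed
  show thesis
  proof (rule that[of k "ch * cb"])
    show "Vector_Spaces.linear (*s) (*s) k" unfolding k_def using fb(2) fh(2) by (rule Vector_Spaces.linear_compose)
    show "inj k" unfolding k_def using fb(3) fh(3) by (simp add: bij_is_inj inj_compose)
    show "ch * cb \<noteq> 0" using fh fb by simp
    show "Q (k x) = ch * cb * Q x" for x using fh fb by (simp add: k_def mult.assoc)
    show "M1 = (\<lambda>I. k ` frame_span e (w0 n ` I)) ` standard_index_sets n"
      unfolding M1 standard_flag_index_sets image_image
      using ws standard_index_sets_subset rank_ge_2 by (intro image_cong refl) (simp add: k)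
    show "M2 = (\<lambda>I. k ` frame_span e I) ` standard_index_sets n"
      unfolding M2 standard_flag_index_sets image_image by (intro image_cong refl) (simp add: k)
  qed
qed

lemma w0_image_index:
  "I \<in> standard_index_sets n \<Longrightarrow> w0 n ` I \<subseteq> frame_index n"
  "card (w0 n ` I) = card I"
  using standard_index_sets_subset rank_ge_2 w0_frame_index inj_w0
  by (auto intro!: card_image simp: inj_on_def inj_def) blast

lemma dim_linear_image:
  assumes "Vector_Spaces.linear (*s) (*s) (k :: 'a ^ 'm \<Rightarrow> 'a ^ 'm)" "inj k"
  shows "vec.dim (k ` U) = vec.dim U"
  using assms by (auto intro: vec.dim_image_eq inj_on_subset)

lemma opposite_points_not_in_generator:
  assumes "opposite_maximal n Q e M1 M2" "4 \<le> n"
    and U: "U1 \<in> M1" "U2 \<in> M2" "vec.dim U1 = 1" "vec.dim U2 = 1"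
    and N: "generator n Q N" "U1 \<subseteq> N"
  shows "\<not> U2 \<subseteq> N"
proof
  assume "U2 \<subseteq> N"
  obtain k c where k: "Vector_Spaces.linear (*s) (*s) k" "inj k" "c \<noteq> 0" "\<And>x. Q (k x) = c * Q x"
    and M: "M1 = (\<lambda>I. k ` frame_span e (w0 n ` I)) ` standard_index_sets n"
    "M2 = (\<lambda>I. k ` frame_span e I) ` standard_index_sets n"
    using opposite_maximal_normal_form[OF assms(1)] by metis
  obtain I1 I2 where I: "I1 \<in> standard_index_sets n" "I2 \<in> standard_index_sets n"
    "U1 = k ` frame_span e (w0 n ` I1)" "U2 = k ` frame_span e I2"
    using U M by auto
  \<comment> \<open>the index sets of the generators have \<open>n > 1\<close> elements\<close>
  have one: "I = {1}" if "I \<in> standard_index_sets n" "card I = 1" for I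
    using that(1) rank_ge_2 by (cases rule: standard_index_setsE) (use that(2) assms(2) in auto)
  have "card I1 = 1" "card I2 = 1"
    using U(3,4) I w0_image_index standard_index_sets_subset rank_ge_2
    by (simp_all add: dim_linear_image[OF k(1,2)] dim_frame_span)
  then have "I1 = {1}" "I2 = {1}" using one I by auto
  moreover have "w0 n 1 = - 1" using assms(2) by (simp add: w0_def)
  ultimately have V: "U1 = k ` vec.span (e (- 1))" "U2 = k ` vec.span (e 1)"
    using I by (auto simp: frame_span_def)
  have "k ` vec.span (e 1 \<union> e (- 1)) \<subseteq> N"
  proof -
    have "k ` (e 1 \<union> e (- 1)) \<subseteq> N"
      using V N \<open>U2 \<subseteq> N\<close> vec.span_superset by blast
    then show ?thesis
      using vec.span_minimal[OF _ generatorD(1)[OF N(1)]] vec.linear_span_image[OF k(1)] by metis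
  qed
  then have "Q x = 0" if "x \<in> vec.span (e 1 \<union> e (- 1))" for x
    using that k(3,4) generatorD(4)[OF N(1)] by (metis image_subset_iff mult_eq_0_iff)
  then have "collinear_points Q (e 1) (e (- 1))"
    by (simp add: collinear_points_def totally_singular_def)
  moreover have "1 \<in> frame_index n" "- 1 \<in> frame_index n" using assms(2) by (auto simp: frame_index_def)
  ultimately show False using frame unfolding polar_frame_def by blast
qed

text \<open>For even \<open>n\<close>, \<open>w\<^sub>0\<close> negates all indices. The two index sets
  of generators agree except for the sign of \<open>n\<close>, so only \<open>n\<close> or only \<open>-
  n\<close> can be common to one of them and the negative of a second one, equal to it or not. This
  bounds the dimension of the intersection by one, and its parity is known.\<close>

lemma opposite_generators_disjoint:
  assumes "opposite_maximal n Q e M1 M2" "even n"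
    and U: "U1 \<in> M1" "U2 \<in> M2" "generator n Q U1" "generator n Q U2" "same_class n U1 U2"
  shows "vec.dim (U1 \<inter> U2) = 0"
proof -
  obtain k c where k: "Vector_Spaces.linear (*s) (*s) k" "inj k" "c \<noteq> 0" "\<And>x. Q (k x) = c * Q x"
    and M: "M1 = (\<lambda>I. k ` frame_span e (w0 n ` I)) ` standard_index_sets n"
    "M2 = (\<lambda>I. k ` frame_span e I) ` standard_index_sets n"
    using opposite_maximal_normal_form[OF assms(1)] by metis
  obtain I1 I2 where I: "I1 \<in> standard_index_sets n" "I2 \<in> standard_index_sets n"
    "U1 = k ` frame_span e (w0 n ` I1)" "U2 = k ` frame_span e I2"
    using U M by auto
  have full: "I = {1..int n} \<or> I = {1..int n - 1} \<union> {- int n}"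
    if "I \<in> standard_index_sets n" "card I = n" for I
    using that(1) rank_ge_2 by (cases rule: standard_index_setsE) (use that(2) rank_ge_2 in auto)
  have "card I1 = n" "card I2 = n"
    using generatorD(3)[OF U(3)] generatorD(3)[OF U(4)] I w0_image_index standard_index_sets_subset rank_ge_2
    by (simp_all add: dim_linear_image[OF k(1,2)] dim_frame_span)
  then have "w0 n ` I1 \<inter> I2 \<subseteq> {int n} \<or> w0 n ` I1 \<inter> I2 \<subseteq> {- int n}"
    using full[OF I(1)] full[OF I(2)] assms(2) by (auto simp: w0_def)
  then have "card (w0 n ` I1 \<inter> I2) \<le> 1"
    by (metis card_mono finite.emptyI finite.insertI is_singletonI is_singleton_altdef)
  moreover have "U1 \<inter> U2 = k ` (frame_span e (w0 n ` I1) \<inter> frame_span e I2)"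
    using I k(2) by (simp add: image_Int)
  ultimately have "vec.dim (U1 \<inter> U2) \<le> 1"
    using I w0_image_index standard_index_sets_subset rank_ge_2
    by (simp add: dim_linear_image[OF k(1,2)] dim_frame_span_Int)
  moreover have "even (vec.dim (U1 \<inter> U2))" using U(5) assms(2) by (simp add: same_class_iff_even)
  moreover have "d = 0" if "d \<le> 1" "even d" for d :: nat using that by presburger
  ultimately show ?thesis by blast
qed


section \<open>Flags of a given type\<close>

definition elements_of_type :: "otype \<Rightarrow> ('a ^ 'm) set set" where
  "elements_of_type t = {U. is_element n Q U \<and> type_of n e U = t}"

lemma same_type_same_dim: "type_of n e U = type_of n e W \<Longrightarrow> vec.dim U = vec.dim W"
  by (auto simp: type_of_def split: if_splits)

lemma flag_element_unique:
  assumes \<Phi>: "is_flag n Q e \<Phi>" and U: "U \<in> \<Phi>" "W \<in> \<Phi>" "type_of n e U = type_of n e W"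
  shows "U = W"
proof -
  have sub: "vec.subspace U" "vec.subspace W"
    using \<Phi> U by (auto simp: is_flag_def is_element_def totally_singular_def)
  have "incident n e U W" using \<Phi> U by (auto simp: is_flag_def)
  moreover have "{type_of n e U, type_of n e W} \<noteq> {Plain n, Primed n}"
    using U(3) by (simp add: doubleton_eq_iff) (metis otype.distinct(1))
  ultimately have "U \<subseteq> W \<or> W \<subseteq> U" by (simp add: incident_def)
  then show ?thesis
    using same_type_same_dim[OF U(3)] vec.subspace_dim_equal[of U W] vec.subspace_dim_equal[of W U] sub by auto
qed

text \<open>Only for generators is this more than a comparison of dimensions: their type is read off
  from the intersection with \<open>E\<close>, which the isometry may move.\<close>

lemma type_of_isometry:
  assumes f: "isometry f" "class_preserving f" and U: "is_element n Q U"
  shows "type_of n e (f ` U) = type_of n e U"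
proof (cases "vec.dim U = n")
  case True
  then have g: "generator n Q U" using U by (simp add: is_element_def generator_def)
  then have "same_class n U (f ` U)" using f by (simp add: class_preserving_def)
  then have "same_class n (f ` U) E \<longleftrightarrow> same_class n U E"
    using same_class_triangle[OF g generator_isometry[OF f(1) g] generator_E] by blast
  then show ?thesis using True by (simp add: type_of_def dim_isometry[OF f(1)])
qed (simp add: type_of_def dim_isometry[OF f(1)])

lemma flag_isometry:
  assumes f: "isometry f" "class_preserving f" and \<Phi>: "\<Phi> \<in> flags_of_type n Q e J"
  shows "(`) f ` \<Phi> \<in> flags_of_type n Q e J"
proof -
  have el: "is_element n Q U" if "U \<in> \<Phi>" for U
    using \<Phi> that by (simp add: flags_of_type_def is_flag_def)
  have ty: "type_of n e (f ` U) = type_of n e U" if "U \<in> \<Phi>" for U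
    using type_of_isometry[OF f el[OF that]] .
  have "is_element n Q (f ` U)" if "U \<in> \<Phi>" for U
    using el[OF that] by (simp add: is_element_def totally_singular_isometry f dim_isometry)
  moreover have "incident n e (f ` U) (f ` W)" if "U \<in> \<Phi>" "W \<in> \<Phi>" for U W
  proof -
    have "incident n e U W" using \<Phi> that by (simp add: flags_of_type_def is_flag_def)
    moreover have "f ` U \<inter> f ` W = f ` (U \<inter> W)"
      using isometry_inj[OF f(1)] by (simp add: image_Int)
    ultimately show ?thesis
      using ty that by (auto simp: incident_def dim_isometry[OF f(1)] split: if_splits)
  qed
  moreover have "flag_type n e ((`) f ` \<Phi>) = flag_type n e \<Phi>"
    unfolding flag_type_def image_image by (rule image_cong) (use ty in auto)
  ultimately show ?thesis using \<Phi> by (auto simp: flags_of_type_def is_flag_def)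
qed

lemma card_flags_through_le:
  assumes f: "isometry f" "class_preserving f"
  shows "card {\<Phi> \<in> flags_of_type n Q e J. U \<in> \<Phi>} \<le> card {\<Phi> \<in> flags_of_type n Q e J. f ` U \<in> \<Phi>}"
proof (rule card_inj_on_le)
  have "inj ((`) f)" by (rule injI) (simp only: inj_image_eq_iff[OF isometry_inj[OF f(1)]])
  then have "inj (\<lambda>\<Phi>. (`) f ` \<Phi>)" by (intro injI) (simp only: inj_image_eq_iff)
  then show "inj_on (\<lambda>\<Phi>. (`) f ` \<Phi>) {\<Phi> \<in> flags_of_type n Q e J. U \<in> \<Phi>}" by (rule inj_on_subset) simp
  show "(\<lambda>\<Phi>. (`) f ` \<Phi>) ` {\<Phi> \<in> flags_of_type n Q e J. U \<in> \<Phi>} \<subseteq> {\<Phi> \<in> flags_of_type n Q e J. f ` U \<in> \<Phi>}"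
    using flag_isometry[OF f] by blast
qed simp

definition transitive_on :: "('a ^ 'm) set set \<Rightarrow> bool" where
  "transitive_on T \<longleftrightarrow> (\<forall>U\<in>T. \<forall>W\<in>T. \<exists>f. isometry f \<and> class_preserving f \<and> f ` U = W)"

text \<open>A flag of type \<open>J\<close> has exactly one element of type \<open>t\<close>, and by
  transitivity every element of type \<open>t\<close> is in the same number \<open>d\<close> of these
  flags. So both cardinalities of flags are \<open>d\<close> times the number of admissible elements of
  type \<open>t\<close>.\<close>

lemma card_flags_ratio:
  assumes t: "t \<in> J" and trans: "transitive_on (elements_of_type t)"
    and ratio: "card (elements_of_type t) = card {U \<in> elements_of_type t. A U} * r"
  shows "card (flags_of_type n Q e J) = card {\<Phi> \<in> flags_of_type n Q e J. \<exists>U\<in>\<Phi>. type_of n e U = t \<and> A U} * r"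
proof -
  let ?T = "elements_of_type t"
  define c where "c U = card {\<Phi> \<in> flags_of_type n Q e J. U \<in> \<Phi>}" for U
  have le: "c U \<le> c W" if UW: "U \<in> ?T" "W \<in> ?T" for U W
  proof -
    obtain f where f: "isometry f" "class_preserving f" "f ` U = W"
      using trans[unfolded transitive_on_def, rule_format, OF UW] by blast
    then show ?thesis using card_flags_through_le[OF f(1,2), of J U] by (simp add: c_def)
  qed
  have const: "c U = c W" if "U \<in> ?T" "W \<in> ?T" for U W
    using le[OF that] le[OF that(2,1)] by (rule le_antisym)
  \<comment> \<open>if there is no element of type \<open>t\<close>, then \<open>d\<close> is arbitrary and both counts are 0\<close>
  define d where "d = c (SOME W. W \<in> ?T)"
  have d: "c U = d" if "U \<in> ?T" for U
    unfolding d_def using const[OF that someI[of "\<lambda>W. W \<in> ?T", OF that]] .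
  have count: "card {\<Phi> \<in> flags_of_type n Q e J. \<exists>U\<in>\<Phi>. type_of n e U = t \<and> P U} = card {U \<in> ?T. P U} * d"
    for P
  proof -
    have "{\<Phi> \<in> flags_of_type n Q e J. \<exists>U\<in>\<Phi>. type_of n e U = t \<and> P U}
        = (\<Union>U\<in>{U \<in> ?T. P U}. {\<Phi> \<in> flags_of_type n Q e J. U \<in> \<Phi>})"
      by (auto simp: elements_of_type_def flags_of_type_def is_flag_def)
    also have "card \<dots> = (\<Sum>U\<in>{U \<in> ?T. P U}. c U)"
      unfolding c_def
    proof (rule card_UN_disjoint)
      show "\<forall>U\<in>{U \<in> ?T. P U}. \<forall>W\<in>{U \<in> ?T. P U}. U \<noteq> W \<longrightarrow>
          {\<Phi> \<in> flags_of_type n Q e J. U \<in> \<Phi>} \<inter> {\<Phi> \<in> flags_of_type n Q e J. W \<in> \<Phi>} = {}"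
        using flag_element_unique unfolding elements_of_type_def flags_of_type_def by blast
    qed simp_all
    also have "\<dots> = (\<Sum>U\<in>{U \<in> ?T. P U}. d)" by (rule sum.cong) (simp_all add: d)
    finally show ?thesis by simp
  qed
  have "{\<Phi> \<in> flags_of_type n Q e J. \<exists>U\<in>\<Phi>. type_of n e U = t \<and> True} = flags_of_type n Q e J"
    using t by (auto simp: flags_of_type_def flag_type_def)
  then have "card (flags_of_type n Q e J) = card ?T * d" using count[of "\<lambda>_. True"] by simp
  then show ?thesis using count[of A] ratio by simp
qed

lemma elements_of_type_point: "4 \<le> n \<Longrightarrow> elements_of_type (Plain 1) = {P. point Q P}"
  by (auto simp: elements_of_type_def is_element_def type_of_def point_def split: if_splits)

lemma elements_of_type_generator:
  assumes "t \<in> {Plain n, Primed n}"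
  shows "elements_of_type t = {U. generator n Q U \<and> same_class n U E = (t = Plain n)}"
  using assms rank_ge_2
  by (auto simp: elements_of_type_def is_element_def type_of_def generator_def split: if_splits)

lemma transitive_on_points: "transitive_on {P. point Q P}"
  unfolding transitive_on_def
proof (intro ballI)
  fix P R assume "P \<in> {P. point Q P}" "R \<in> {P. point Q P}"
  then have P: "point Q P" and R: "point Q R" by auto
  have span: "\<exists>x. x \<noteq> 0 \<and> Q x = 0 \<and> S = vec.span {x}" if S: "point Q S" for S
  proof -
    have s: "vec.subspace S" "vec.dim S = 1" using S by (auto simp: point_def totally_singular_def)
    then have "\<not> S \<subseteq> {0}" by (metis vec.dim_eq_0 zero_neq_one)
    then obtain x where x: "x \<in> S" "x \<noteq> 0" by blast
    then have "vec.span {x} = S" using s by (intro vec.subspace_dim_equal vec.span_minimal) auto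
    moreover have "Q x = 0" using x S by (simp add: point_def totally_singular_def)
    ultimately show ?thesis using x by blast
  qed
  obtain x y where xy: "x \<noteq> 0" "Q x = 0" "P = vec.span {x}" "y \<noteq> 0" "Q y = 0" "R = vec.span {y}"
    using span[OF P] span[OF R] by blast
  obtain f where f: "isometry f" "class_preserving f" "f x = y"
    using class_preserving_transitive_singular_vectors xy by metis
  have "f ` P = R" using vec.linear_span_image[of f "{x}"] f xy by (simp add: isometry_def)
  then show "\<exists>f. isometry f \<and> class_preserving f \<and> f ` P = R" using f by blast
qed

lemma transitive_on_class: "transitive_on {U. generator n Q U \<and> same_class n U E = b}"
  unfolding transitive_on_def
proof (intro ballI)
  fix U W
  assume U: "U \<in> {U. generator n Q U \<and> same_class n U E = b}"
    and W: "W \<in> {U. generator n Q U \<and> same_class n U E = b}"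
  then have "same_class n U W"
    using same_class_triangle[of U W E] generator_E by blast
  then show "\<exists>f. isometry f \<and> class_preserving f \<and> f ` U = W"
    using class_preserving_transitive_generators[of U W] U W by blast
qed

lemma EKR_setI:
  assumes "w0_type n ` J = J" "C \<subseteq> flags_of_type n Q e J"
    and "\<And>\<Phi> \<Psi> M1 M2. \<Phi> \<in> C \<Longrightarrow> \<Psi> \<in> C \<Longrightarrow> \<Phi> \<subseteq> M1 \<Longrightarrow> \<Psi> \<subseteq> M2 \<Longrightarrow> \<not> opposite_maximal n Q e M1 M2"
  shows "EKR_set n Q e J C"
  unfolding EKR_set_def pairwise_def
proof (intro conjI ballI impI assms(1,2))
  fix \<Phi> \<Psi> assume "\<Phi> \<in> C" "\<Psi> \<in> C"
  then show "\<not> opposite_flags n Q e \<Phi> \<Psi>"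
    unfolding opposite_flags_def using assms(3) by blast
qed

section \<open>The three families of flags\<close>

lemma point_flags_in_generator:
  assumes n: "4 \<le> n" and J: "w0_type n ` J = J" "Plain 1 \<in> J" and N: "generator n Q N"
  defines "C \<equiv> {\<Phi> \<in> flags_of_type n Q e J. \<exists>P\<in>\<Phi>. type_of n e P = Plain 1 \<and> P \<subseteq> N}"
  shows "EKR_set n Q e J C" "card (flags_of_type n Q e J) = card C * (1 + q ^ (n - 1))"
proof -
  have dim1: "vec.dim U = 1" if "type_of n e U = Plain 1" for U
    using that n by (auto simp: type_of_def split: if_splits)
  show "EKR_set n Q e J C"
  proof (rule EKR_setI[OF J(1)])
    show "C \<subseteq> flags_of_type n Q e J" by (auto simp: C_def)
    fix \<Phi> \<Psi> M1 M2 assume "\<Phi> \<in> C" "\<Psi> \<in> C" "\<Phi> \<subseteq> M1" "\<Psi> \<subseteq> M2"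
    then obtain U1 U2 where "U1 \<in> M1" "vec.dim U1 = 1" "U1 \<subseteq> N" "U2 \<in> M2" "vec.dim U2 = 1" "U2 \<subseteq> N"
      unfolding C_def using dim1 by blast
    then show "\<not> opposite_maximal n Q e M1 M2"
      using opposite_points_not_in_generator n N by blast
  qed
  have "card (elements_of_type (Plain 1)) = card {U \<in> elements_of_type (Plain 1). U \<subseteq> N} * (1 + q ^ (n - 1))"
    using card_points_ratio[OF N] by (simp only: elements_of_type_point[OF n] mem_Collect_eq)
  then show "card (flags_of_type n Q e J) = card C * (1 + q ^ (n - 1))"
    unfolding C_def using transitive_on_points
    by (intro card_flags_ratio J) (simp_all only: elements_of_type_point[OF n])
qed

text \<open>Both families given by conditions on a generator rest on the same fact: for even
  \<open>n\<close>, opposite flags have generators of type \<open>t\<close> without a common point. The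
  condition \<open>A\<close> has to prevent this.\<close>

lemma generators_of_flags_not_opposite:
  assumes n: "even n" and t: "t \<in> {Plain n, Primed n}" and J: "w0_type n ` J = J"
    and C: "C = {\<Phi> \<in> flags_of_type n Q e J. \<exists>U\<in>\<Phi>. type_of n e U = t \<and> A U}"
    and meet: "\<And>U W. generator n Q U \<Longrightarrow> generator n Q W \<Longrightarrow> type_of n e U = t \<Longrightarrow> type_of n e W = t \<Longrightarrow>
      A U \<Longrightarrow> A W \<Longrightarrow> vec.dim (U \<inter> W) \<noteq> 0"
  shows "EKR_set n Q e J C"
proof (rule EKR_setI[OF J])
  show "C \<subseteq> flags_of_type n Q e J" by (auto simp: C)
  fix \<Phi> \<Psi> M1 M2 assume *: "\<Phi> \<in> C" "\<Psi> \<in> C" "\<Phi> \<subseteq> M1" "\<Psi> \<subseteq> M2"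
  obtain U1 U2 where U: "U1 \<in> \<Phi>" "type_of n e U1 = t" "A U1" "U2 \<in> \<Psi>" "type_of n e U2 = t" "A U2"
    using * unfolding C by blast
  then have "U1 \<in> elements_of_type t" "U2 \<in> elements_of_type t"
    using * by (auto simp: C elements_of_type_def flags_of_type_def is_flag_def)
  then have g: "generator n Q U1" "generator n Q U2" "same_class n U1 E = same_class n U2 E"
    using elements_of_type_generator[OF t] by auto
  then have "same_class n U1 U2" using same_class_triangle[OF g(1,2) generator_E] by blast
  then show "\<not> opposite_maximal n Q e M1 M2"
    using opposite_generators_disjoint[OF _ n, of M1 M2 U1 U2] meet[of U1 U2] g U * by blast
qed

lemma generator_flags_through_point:
  assumes n: "even n" and t: "t \<in> {Plain n, Primed n}" and J: "w0_type n ` J = J" "t \<in> J" and P: "point Q P"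
  defines "C \<equiv> {\<Phi> \<in> flags_of_type n Q e J. \<exists>U\<in>\<Phi>. type_of n e U = t \<and> P \<subseteq> U}"
  shows "EKR_set n Q e J C" "card (flags_of_type n Q e J) = card C * (1 + q ^ (n - 1))"
proof -
  show "EKR_set n Q e J C"
  proof (rule generators_of_flags_not_opposite[OF n t J(1) C_def[THEN meta_eq_to_obj_eq]])
    fix U W assume "P \<subseteq> U" "P \<subseteq> W"
    then have "vec.dim P \<le> vec.dim (U \<inter> W)" by (intro vec.dim_subset) auto
    moreover have "vec.dim P = 1" using P by (simp add: point_def)
    ultimately show "vec.dim (U \<inter> W) \<noteq> 0" by linarith
  qed
  have "card (elements_of_type t) = card {U \<in> elements_of_type t. P \<subseteq> U} * (1 + q ^ (n - 1))"
    using card_generators_of_class_ratio[OF generator_E P, of "t = Plain n"]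
    by (simp only: elements_of_type_generator[OF t] mem_Collect_eq conj_assoc)
  then show "card (flags_of_type n Q e J) = card C * (1 + q ^ (n - 1))"
    unfolding C_def using transitive_on_class[of "t = Plain n"]
    by (intro card_flags_ratio J) (simp_all only: elements_of_type_generator[OF t])
qed

lemma generator_flags_adjacent_to_generator:
  assumes n: "n = 4" and t: "(t, t') \<in> {(Plain n, Primed n), (Primed n, Plain n)}"
    and J: "w0_type n ` J = J" "t \<in> J"
    and W: "generator n Q W" "type_of n e W = t'"
  defines "C \<equiv> {\<Phi> \<in> flags_of_type n Q e J. \<exists>U\<in>\<Phi>. type_of n e U = t \<and> incident n e U W}"
  shows "EKR_set n Q e J C" "card (flags_of_type n Q e J) = card C * (1 + q ^ (n - 1))"
proof -
  have t1: "t \<in> {Plain n, Primed n}" using t by auto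
  have inc: "incident n e U W \<longleftrightarrow> vec.dim (U \<inter> W) = n - 1" if "type_of n e U = t" for U
    using that t W(2) by (auto simp: incident_def)
  show "EKR_set n Q e J C"
  proof (rule generators_of_flags_not_opposite[OF _ t1 J(1) C_def[THEN meta_eq_to_obj_eq]])
    fix U V assume UV: "generator n Q U" "generator n Q V" "type_of n e U = t" "type_of n e V = t"
      "incident n e U W" "incident n e V W"
    then have d: "vec.dim (U \<inter> W) = 3" "vec.dim (V \<inter> W) = 3" using inc n by auto
    note s = generatorD(1)[OF UV(1)] generatorD(1)[OF UV(2)] generatorD(1)[OF W(1)]
    \<comment> \<open>two three-dimensional subspaces of the four-dimensional \<open>W\<close> meet in dimension at least 2\<close>
    let ?S = "{x + y |x y. x \<in> U \<inter> W \<and> y \<in> V \<inter> W}"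
    have "vec.dim ?S + vec.dim ((U \<inter> W) \<inter> (V \<inter> W)) = 6"
      using vec.dim_sums_Int[of "U \<inter> W" "V \<inter> W"] s d by (simp add: vec.subspace_inter)
    moreover have "?S \<subseteq> W" using s by (auto simp: vec.subspace_add)
    then have "vec.dim ?S \<le> 4" using vec.dim_subset[of ?S W] generatorD(3)[OF W(1)] n by simp
    moreover have "vec.dim ((U \<inter> W) \<inter> (V \<inter> W)) \<le> vec.dim (U \<inter> V)" by (intro vec.dim_subset) auto
    ultimately show "vec.dim (U \<inter> V) \<noteq> 0" by linarith
  qed (simp add: n)
  have "W \<in> elements_of_type t'"
    using W rank_ge_2 by (simp add: elements_of_type_def is_element_def generator_def)
  then have WE: "same_class n W E = (t' = Plain n)"
    using elements_of_type_generator[of t'] t by auto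
  have "elements_of_type t = {U. generator n Q U \<and> \<not> same_class n U W}"
    using elements_of_type_generator[OF t1] same_class_triangle[OF _ W(1) generator_E] WE t by auto
  moreover have "{U \<in> elements_of_type t. incident n e U W} = {U \<in> elements_of_type t. vec.dim (U \<inter> W) = n - 1}"
    using inc by (auto simp: elements_of_type_def)
  ultimately have "card (elements_of_type t) = card {U \<in> elements_of_type t. incident n e U W} * (1 + q ^ (n - 1))"
    using card_adjacent_generators_ratio[OF n W(1)] by (simp only: mem_Collect_eq conj_assoc)
  moreover have "transitive_on (elements_of_type t)"
    using transitive_on_class by (simp only: elements_of_type_generator[OF t1])
  ultimately show "card (flags_of_type n Q e J) = card C * (1 + q ^ (n - 1))"
    unfolding C_def by (intro card_flags_ratio J)
qed

end

theorem theorem3p28: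
  fixes Q :: "'a::{field,finite} ^ 'm \<Rightarrow> 'a"
    and e :: "int \<Rightarrow> ('a ^ 'm) set"
    and n q :: nat
    and J :: "otype set"
    and C :: "('a ^ 'm) set set set"
  assumes "n \<ge> 4"
    and "q = CARD('a)"
    and "hyperbolic_form n Q"
    and "polar_frame n Q e"
    and "J \<subseteq> otypes n"
    and "w0_type n ` J = J"
    and "(Plain 1 \<in> J \<and>
            (\<exists>N. generator n Q N \<and>
               C = {\<Phi> \<in> flags_of_type n Q e J. \<exists>P\<in>\<Phi>. type_of n e P = Plain 1 \<and> P \<subseteq> N}))
       \<or> (even n \<and>
            (\<exists>t\<in>{Plain n, Primed n}. t \<in> J \<and>
               (\<exists>P. point Q P \<and>
                  C = {\<Phi> \<in> flags_of_type n Q e J. \<exists>U\<in>\<Phi>. type_of n e U = t \<and> P \<subseteq> U})))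
       \<or> (n = 4 \<and>
            (\<exists>(t, t')\<in>{(Plain n, Primed n), (Primed n, Plain n)}. t \<in> J \<and>
               (\<exists>W. generator n Q W \<and> type_of n e W = t' \<and>
                  C = {\<Phi> \<in> flags_of_type n Q e J.
                         \<exists>U\<in>\<Phi>. type_of n e U = t \<and> incident n e U W})))"
  shows "EKR_set n Q e J C \<and>
         real (card C) = real (card (flags_of_type n Q e J)) / (1 + real q ^ (n - 1))"
proof -
  interpret framed_space Q n q e
    using assms by unfold_locales auto
  have "EKR_set n Q e J C \<and> card (flags_of_type n Q e J) = card C * (1 + q ^ (n - 1))"
    using assms(7)
  proof (elim disjE conjE bexE exE)
    fix N assume "Plain 1 \<in> J" "generator n Q N"
      "C = {\<Phi> \<in> flags_of_type n Q e J. \<exists>P\<in>\<Phi>. type_of n e P = Plain 1 \<and> P \<subseteq> N}"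
    then show ?thesis using point_flags_in_generator[OF assms(1,6), of N] by simp
  next
    fix t P assume "even n" "t \<in> {Plain n, Primed n}" "t \<in> J" "point Q P"
      "C = {\<Phi> \<in> flags_of_type n Q e J. \<exists>U\<in>\<Phi>. type_of n e U = t \<and> P \<subseteq> U}"
    then show ?thesis using generator_flags_through_point[OF _ _ assms(6), of t P] by simp
  next
    fix p :: "otype \<times> otype"
    assume n: "n = 4" and p: "p \<in> {(Plain n, Primed n), (Primed n, Plain n)}"
      and *: "case p of (t, t') \<Rightarrow> t \<in> J \<and>
        (\<exists>W. generator n Q W \<and> type_of n e W = t' \<and>
          C = {\<Phi> \<in> flags_of_type n Q e J. \<exists>U\<in>\<Phi>. type_of n e U = t \<and> incident n e U W})"
    obtain t t' where tt: "p = (t, t')" by (cases p)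
    then obtain W where "t \<in> J" "generator n Q W" "type_of n e W = t'"
      "C = {\<Phi> \<in> flags_of_type n Q e J. \<exists>U\<in>\<Phi>. type_of n e U = t \<and> incident n e U W}"
      using * by auto
    then show ?thesis using generator_flags_adjacent_to_generator[OF n _ assms(6), of t t' W] p tt by simp
  qed
  moreover have "1 + real q ^ (n - 1) \<noteq> 0" by (smt (verit) of_nat_0_le_iff zero_le_power)
  ultimately show ?thesis by (simp add: field_simps)
qed

end
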